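(* Let $n\in\mathbb{N}_+$, $r_1,\ldots,r_n\ge 2$ integers, $s,t\in[n]$. The set of minimal primes over $I^{\langle s,t\rangle}$ in $R$ consists of all the ideals of the form $P^{\langle s,t\rangle}_{\mathcal{S}}$, where $\mathcal{S}\subseteq\mathcal{N}$ is a maximal $(s,t)$-switchable set.
   Context: Notation: $[r]=\{1,\ldots,r\}$, $\mathcal{N}=[r_1]\times\cdots\times[r_n]$, $\Bbbk$ is an arbitrary field. Two indices $a,b\in\mathcal{N}$ are $s$-equivalent if $\sum_{i=1}^s a_i=\sum_{i=1}^s b_i$ and $a_i=b_i$ for $i=s+1,\ldots,n$. $R=\Bbbk[x_a: a\in\mathcal{N}]$ is the polynomial ring where the variables are identified by $x_a=x_b$ if and only if $a,b$ are $s$-equivalent (so variables correspond bijectively to $s$-equivalence classes). For $i\in[n]$ and $a,b\in\mathcal{N}$, $\mathrm{sw}(i,a,b)\in\mathcal{N}$ is obtained from $a$ by replacing its $i$-th component by $b_i$; $f_{i,a,b}=x_ax_b-x_{\mathrm{sw}(i,a,b)}x_{\mathrm{sw}(i,b,a)}$; $\mathrm{d}(a,b)=\#\{i\in[n]: a_i\ne b_i\}$. The ideal $I^{\langle s,t\rangle}\subseteq R$ is generated by all $f_{i,a,b}$ with $a,b\in\mathcal{N}$, $\mathrm{d}(a,b)=2$, $i\in[t]$. A subset $\mathcal{S}\subseteq\mathcal{N}$ is $(s,t)$-switchable if (i) for all $a,b\in\mathcal{S}$ with $\mathrm{d}(a,b)=2$ and all $i\in[t]$, $\mathrm{sw}(i,a,b)\in\mathcal{S}$;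 and (ii) $\mathcal{S}$ is closed under $s$-equivalence. Indices $a,b\in\mathcal{S}$ are connected in $\mathcal{S}$ if there are $c_0=a,c_1,\ldots,c_k=b$ in $\mathcal{S}$ with $\mathrm{d}(c_{j-1},c_j)=1$ for all $j\in[k]$. For an $(s,t)$-switchable set $\mathcal{S}$ put $\widetilde{I}^{\langle s,t\rangle}_{\mathcal{S}}=(f_{i,a,b}: i\in[t],\ a,b\text{ connected in }\mathcal{S})$, $\mathrm{Var}^{\langle s,t\rangle}_{\mathcal{S}}=(x_a: a\notin\mathcal{S})$, $P^{\langle s,t\rangle}_{\mathcal{S}}=\mathrm{Var}^{\langle s,t\rangle}_{\mathcal{S}}+\widetilde{I}^{\langle s,t\rangle}_{\mathcal{S}}$. An $(s,t)$-switchable set $\mathcal{S}$ is maximal $(s,t)$-switchable if for every $(s,t)$-switchable set $\mathcal{T}$ properly containing $\mathcal{S}$ the ideals $P^{\langle s,t\rangle}_{\mathcal{S}}$ and $P^{\langle s,t\rangle}_{\mathcal{T}}$ are incomparable with respect to inclusion. *)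

theory Defs
  imports "HOL-Algebra.Ideal" "HOL-Library.Poly_Mapping"
begin

text \<open>
  An element of \<open>('v, 'k) mpoly\<close> maps finitely many monomials (exponent vectors of finite
  support) to their coefficients; addition and multiplication are those of the library.
\<close>

type_synonym ('v, 'k) mpoly = "('v \<Rightarrow>\<^sub>0 nat) \<Rightarrow>\<^sub>0 'k"

text \<open>
  The polynomial ring \<open>'k[x\<^sub>v : v \<in> V]\<close>: only monomials in the variables from \<open>V\<close> may occur.
\<close>

definition poly_ring_over :: "'v set \<Rightarrow> ('v, 'k::field) mpoly ring" where
  "poly_ring_over V =
     \<lparr>carrier = {p. \<forall>m \<in> Poly_Mapping.keys p. Poly_Mapping.keys m \<subseteq> V},
      mult = (*), one = 1, zero = 0, add = (+)\<rparr>"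

definition pvar :: "'v \<Rightarrow> ('v, 'k::field) mpoly" where
  "pvar v = Poly_Mapping.single (Poly_Mapping.single v 1) 1"

definition minimal_primes_over :: "('a, 'b) ring_scheme \<Rightarrow> 'a set \<Rightarrow> 'a set set" where
  "minimal_primes_over R I =
     {P. primeideal P R \<and> I \<subseteq> P \<and>
         (\<forall>Q. primeideal Q R \<and> I \<subseteq> Q \<and> Q \<subseteq> P \<longrightarrow> Q = P)}"

text \<open>
  An index \<open>(a\<^sub>1, \<dots>, a\<^sub>n)\<close> is a function on \<open>nat\<close> whose values outside \<open>{1..n}\<close> are
  \<open>undefined\<close>, so that equality of functions is equality of tuples.
\<close>

type_synonym index = "nat \<Rightarrow> nat"

definition indices :: "nat \<Rightarrow> (nat \<Rightarrow> nat) \<Rightarrow> index set" where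
  "indices n r = (\<Pi>\<^sub>E i \<in> {1..n}. {1..r i})"

definition s_equiv :: "nat \<Rightarrow> (nat \<Rightarrow> nat) \<Rightarrow> nat \<Rightarrow> (index \<times> index) set" where
  "s_equiv n r s =
     {(a, b). a \<in> indices n r \<and> b \<in> indices n r \<and>
        (\<Sum>i = 1..s. a i) = (\<Sum>i = 1..s. b i) \<and> (\<forall>i \<in> {s+1..n}. a i = b i)}"

definition sw :: "nat \<Rightarrow> index \<Rightarrow> index \<Rightarrow> index" where
  "sw i a b = a(i := b i)"

definition idist :: "nat \<Rightarrow> index \<Rightarrow> index \<Rightarrow> nat" where
  "idist n a b = card {i \<in> {1..n}. a i \<noteq> b i}"

text \<open>The variables are the \<open>s\<close>-equivalence classes of indices.\<close>

type_synonym 'k spoly = "(index set, 'k) mpoly"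

definition R_ring :: "nat \<Rightarrow> (nat \<Rightarrow> nat) \<Rightarrow> nat \<Rightarrow> 'k::field spoly ring" where
  "R_ring n r s = poly_ring_over (indices n r // s_equiv n r s)"

definition xvar :: "nat \<Rightarrow> (nat \<Rightarrow> nat) \<Rightarrow> nat \<Rightarrow> index \<Rightarrow> 'k::field spoly" where
  "xvar n r s a = pvar (s_equiv n r s `` {a})"

definition fbin :: "nat \<Rightarrow> (nat \<Rightarrow> nat) \<Rightarrow> nat \<Rightarrow> nat \<Rightarrow> index \<Rightarrow> index \<Rightarrow> 'k::field spoly" where
  "fbin n r s i a b = xvar n r s a * xvar n r s b - xvar n r s (sw i a b) * xvar n r s (sw i b a)"

definition I_ideal :: "nat \<Rightarrow> (nat \<Rightarrow> nat) \<Rightarrow> nat \<Rightarrow> nat \<Rightarrow> 'k::field spoly set" where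
  "I_ideal n r s t =
     Idl\<^bsub>R_ring n r s\<^esub>
       {fbin n r s i a b | i a b.
          i \<in> {1..t} \<and> a \<in> indices n r \<and> b \<in> indices n r \<and> idist n a b = 2}"

definition switchable :: "nat \<Rightarrow> (nat \<Rightarrow> nat) \<Rightarrow> nat \<Rightarrow> nat \<Rightarrow> index set \<Rightarrow> bool" where
  "switchable n r s t S \<longleftrightarrow>
     S \<subseteq> indices n r \<and>
     (\<forall>a \<in> S. \<forall>b \<in> S. idist n a b = 2 \<longrightarrow> (\<forall>i \<in> {1..t}. sw i a b \<in> S)) \<and>
     (\<forall>a \<in> S. \<forall>b. (a, b) \<in> s_equiv n r s \<longrightarrow> b \<in> S)"

definition connected_in :: "nat \<Rightarrow> index set \<Rightarrow> index \<Rightarrow> index \<Rightarrow> bool" where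
  "connected_in n S a b \<longleftrightarrow>
     (\<exists>(k::nat) (c::nat \<Rightarrow> index). c 0 = a \<and> c k = b \<and> (\<forall>j \<le> k. c j \<in> S) \<and>
        (\<forall>j \<in> {1..k}. idist n (c (j - 1)) (c j) = 1))"

definition I_tilde :: "nat \<Rightarrow> (nat \<Rightarrow> nat) \<Rightarrow> nat \<Rightarrow> nat \<Rightarrow> index set \<Rightarrow> 'k::field spoly set" where
  "I_tilde n r s t S =
     Idl\<^bsub>R_ring n r s\<^esub>
       {fbin n r s i a b | i a b. i \<in> {1..t} \<and> a \<in> S \<and> b \<in> S \<and> connected_in n S a b}"

definition Var_ideal :: "nat \<Rightarrow> (nat \<Rightarrow> nat) \<Rightarrow> nat \<Rightarrow> index set \<Rightarrow> 'k::field spoly set" where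
  "Var_ideal n r s S = Idl\<^bsub>R_ring n r s\<^esub> {xvar n r s a | a. a \<in> indices n r - S}"

definition P_ideal :: "nat \<Rightarrow> (nat \<Rightarrow> nat) \<Rightarrow> nat \<Rightarrow> nat \<Rightarrow> index set \<Rightarrow> 'k::field spoly set" where
  "P_ideal n r s t S = Var_ideal n r s S <+>\<^bsub>R_ring n r s\<^esub> I_tilde n r s t S"

text \<open>
  Maximality compares ideals over the given field, which is therefore passed as a type argument.
\<close>

definition maximal_switchable ::
  "'k::field itself \<Rightarrow> nat \<Rightarrow> (nat \<Rightarrow> nat) \<Rightarrow> nat \<Rightarrow> nat \<Rightarrow> index set \<Rightarrow> bool" where
  "maximal_switchable K n r s t S \<longleftrightarrow>
     switchable n r s t S \<and>
     (\<forall>T. switchable n r s t T \<and> S \<subset> T \<longrightarrow>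
        \<not> (P_ideal n r s t S :: 'k spoly set) \<subseteq> P_ideal n r s t T \<and>
        \<not> (P_ideal n r s t T :: 'k spoly set) \<subseteq> P_ideal n r s t S)"

lemma cring_poly_ring_over: "cring (poly_ring_over V :: ('v, 'k::field) mpoly ring)"
proof -
  define C where "C = {p :: ('v, 'k) mpoly. \<forall>m \<in> Poly_Mapping.keys p. Poly_Mapping.keys m \<subseteq> V}"
  have R: "poly_ring_over V = \<lparr>carrier = C, mult = (*), one = 1, zero = 0, add = (+)\<rparr>"
    by (simp add: poly_ring_over_def C_def)
  have add: "p + q \<in> C" if "p \<in> C" "q \<in> C" for p q
    using that Poly_Mapping.keys_add[of p q] unfolding C_def by blast
  have mult: "p * q \<in> C" if "p \<in> C" "q \<in> C" for p q
    unfolding C_def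
  proof (clarify)
    fix m v assume "m \<in> Poly_Mapping.keys (p * q)" and v: "v \<in> Poly_Mapping.keys m"
    then obtain m1 m2 where "m1 \<in> Poly_Mapping.keys p" "m2 \<in> Poly_Mapping.keys q" "m = m1 + m2"
      using Poly_Mapping.keys_mult[of p q] by blast
    then show "v \<in> V"
      using that v Poly_Mapping.keys_add[of m1 m2] unfolding C_def by blast
  qed
  have zero: "0 \<in> C" and one: "1 \<in> C" by (simp_all add: C_def)
  have uminus: "- p \<in> C" if "p \<in> C" for p
    using that by (simp add: C_def keys.rep_eq)
  show ?thesis
  proof (rule cringI)
    show "abelian_group (poly_ring_over V :: ('v, 'k) mpoly ring)"
    proof (rule abelian_groupI)
      fix p assume "p \<in> carrier (poly_ring_over V :: ('v, 'k) mpoly ring)"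
      then show "\<exists>q \<in> carrier (poly_ring_over V). q \<oplus>\<^bsub>poly_ring_over V\<^esub> p = \<zero>\<^bsub>poly_ring_over V\<^esub>"
        by (intro bexI[of _ "- p"]) (simp_all add: R uminus)
    qed (simp_all add: R add zero ac_simps)
    show "comm_monoid (poly_ring_over V :: ('v, 'k) mpoly ring)"
      by (rule comm_monoidI) (simp_all add: R mult one ac_simps)
  qed (simp add: R distrib_right)
qed

lemma equiv_s_equiv: "equiv (indices n r) (s_equiv n r s)"
  by (auto simp: equiv_def refl_on_def sym_def trans_def s_equiv_def)

lemma pvar_eq_iff: "(pvar v :: ('v, 'k::field) mpoly) = pvar w \<longleftrightarrow> v = w"
proof
  assume "(pvar v :: ('v, 'k) mpoly) = pvar w"
  then have "Poly_Mapping.keys (pvar v :: ('v, 'k) mpoly) = Poly_Mapping.keys (pvar w :: ('v, 'k) mpoly)"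
    by simp
  then have "Poly_Mapping.single v (1::nat) = Poly_Mapping.single w 1"
    by (simp add: pvar_def)
  then have "Poly_Mapping.keys (Poly_Mapping.single v (1::nat)) = Poly_Mapping.keys (Poly_Mapping.single w (1::nat))"
    by simp
  then show "v = w" by simp
qed simp

lemma xvar_eq_iff:
  assumes "a \<in> indices n r" "b \<in> indices n r"
  shows "(xvar n r s a :: 'k::field spoly) = xvar n r s b \<longleftrightarrow> (a, b) \<in> s_equiv n r s"
  unfolding xvar_def pvar_eq_iff using eq_equiv_class_iff[OF equiv_s_equiv assms] .

lemma xvar_closed:
  assumes "a \<in> indices n r"
  shows "(xvar n r s a :: 'k::field spoly) \<in> carrier (R_ring n r s)"
  using quotientI[OF assms] by (simp add: xvar_def pvar_def R_ring_def poly_ring_over_def)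

lemma sw_in_indices:
  assumes "a \<in> indices n r" "b \<in> indices n r" "i \<in> {1..n}"
  shows "sw i a b \<in> indices n r"
  using assms by (auto simp: sw_def indices_def PiE_iff extensional_def)

end

theory Submission
  imports Defs "HOL-Library.Multiset"
begin

text \<open>
  The ideals \<open>P\<^sub>S\<close> of switchable sets \<open>S\<close> are primes that contain \<open>I\<close>, and every prime over \<open>I\<close>
  contains one of them; the theorem then follows because \<open>S\<close> can be recovered from \<open>P\<^sub>S\<close> as the set of
  indices whose variable lies outside \<open>P\<^sub>S\<close>.

  A prime \<open>Q\<close> over \<open>I\<close> contains \<open>P\<^sub>S\<close> for the set \<open>S\<close> of indices whose variable is not in \<open>Q\<close>. The
  binomials of pairs at distance two are in \<open>Q\<close> by assumption; cancelling variables of \<open>S\<close> along a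
  path inside \<open>S\<close> gives the binomials of all connected pairs (\<open>fbin_in_prime\<close>).

  Primality of \<open>P\<^sub>S\<close>, over an arbitrary field, comes from writing \<open>P\<^sub>S\<close> as the kernel of a map that
  sends each variable to a monomial or to zero (\<open>P_ideal_toric\<close>). For an index \<open>a\<close> in a connected
  component of \<open>S\<close>, the monomial records the component together with the sum of the first \<open>s\<close>
  coordinates of \<open>a\<close>, each single coordinate between \<open>s\<close> and \<open>t\<close>, and the tuple of coordinates beyond
  both \<open>s\<close> and \<open>t\<close>. That these data determine a monomial modulo \<open>P\<^sub>S\<close> is a statement about multisets of
  indices (\<open>invariants_complete\<close>): of two multisets with equal data, one can be transformed into the other by
  switches within components and by exchanging equivalent indices. One entry is fitted to a prescribed
  one, coordinate by coordinate, and then removed. The delicate coordinate is the sum: for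
  \<open>s \<ge> 2\<close> two connected indices can trade a single unit of their sums within the bounds, even if only
  the first coordinate may be switched (\<open>transfer_unit\<close>). Moreover, the components must not share variables,
  which holds since equivalent indices of \<open>S\<close> are connected (\<open>equiv_conn\<close>); both facts use
  \<open>r\<^sub>i \<ge> 2\<close>. For \<open>s = 1\<close> the sum is just a coordinate, and the case is treated as \<open>s = 0\<close>.
\<close>

section \<open>Ideals of polynomial rings\<close>

abbreviation vars_of :: "('v \<Rightarrow>\<^sub>0 nat) \<Rightarrow> 'v set" where
  "vars_of m \<equiv> Poly_Mapping.keys m"

lemma poly_ring_over_simps:
  "p \<in> carrier (poly_ring_over V) \<longleftrightarrow> (\<forall>m \<in> Poly_Mapping.keys p. vars_of m \<subseteq> V)"
  "p \<otimes>\<^bsub>poly_ring_over V\<^esub> q = p * q" "p \<oplus>\<^bsub>poly_ring_over V\<^esub> q = p + q"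
  "\<one>\<^bsub>poly_ring_over V\<^esub> = 1" "\<zero>\<^bsub>poly_ring_over V\<^esub> = 0"
  by (simp_all add: poly_ring_over_def)

lemma poly_ring_over_ring: "ring (poly_ring_over V :: ('v, 'k::field) mpoly ring)"
  using cring_poly_ring_over cring_def by blast

lemma single_in_poly_ring:
  "vars_of m \<subseteq> V \<Longrightarrow> Poly_Mapping.single m c \<in> carrier (poly_ring_over V)"
  by (auto simp: poly_ring_over_simps split: if_splits)

lemma poly_ideal_closed:
  fixes J :: "('v, 'k::field) mpoly set"
  assumes "ideal J (poly_ring_over V)"
  shows poly_ideal_zero: "0 \<in> J"
    and poly_ideal_add: "p \<in> J \<Longrightarrow> q \<in> J \<Longrightarrow> p + q \<in> J"
    and poly_ideal_mult: "p \<in> J \<Longrightarrow> q \<in> carrier (poly_ring_over V) \<Longrightarrow> q * p \<in> J"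
    and poly_ideal_diff: "p \<in> J \<Longrightarrow> q \<in> J \<Longrightarrow> p - q \<in> J"
proof -
  interpret J: ideal J "poly_ring_over V" by fact
  show z: "0 \<in> J"
    using additive_subgroup.zero_closed[OF J.additive_subgroup_axioms] by (simp add: poly_ring_over_simps(5))
  show a: "p \<in> J \<Longrightarrow> q \<in> J \<Longrightarrow> p + q \<in> J" for p q
    using additive_subgroup.a_closed[OF J.additive_subgroup_axioms, of p q]
    by (simp add: poly_ring_over_simps(3))
  show m: "p \<in> J \<Longrightarrow> q \<in> carrier (poly_ring_over V) \<Longrightarrow> q * p \<in> J" for p q
    using J.I_l_closed[of p q] by (simp add: poly_ring_over_simps(2))
  have u: "p \<in> J \<Longrightarrow> - p \<in> J" for p
  proof -
    assume "p \<in> J"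
    moreover have "Poly_Mapping.single 0 (- 1) \<in> carrier (poly_ring_over V :: ('v, 'k) mpoly ring)"
      by (rule single_in_poly_ring) simp
    moreover have "Poly_Mapping.single 0 (- 1) = (- 1 :: ('v, 'k) mpoly)"
      by (simp add: single_uminus)
    ultimately show "- p \<in> J" using m by fastforce
  qed
  show "p \<in> J \<Longrightarrow> q \<in> J \<Longrightarrow> p - q \<in> J"
    using a[of p "- q"] u[of q] by simp
qed

lemma poly_ideal_sum:
  assumes "ideal J (poly_ring_over V)" "\<And>x. x \<in> A \<Longrightarrow> f x \<in> J"
  shows "sum f A \<in> J"
  using assms(2) by (induction A rule: infinite_finite_induct)
    (auto intro: poly_ideal_add[OF assms(1)] poly_ideal_zero[OF assms(1)])

section \<open>Kernels of monomial maps\<close>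

lemma sum_monomials: "(\<Sum>m \<in> Poly_Mapping.keys p. Poly_Mapping.single m (Poly_Mapping.lookup p m)) = p"
  by (rule poly_mapping_eqI)
    (simp add: lookup_sum lookup_single when_def in_keys_iff)

lemma vars_of_add: "vars_of (m + m') = vars_of m \<union> vars_of m'"
  by (auto simp: in_keys_iff lookup_add)

definition mon_weight :: "('v \<Rightarrow> nat) \<Rightarrow> ('v \<Rightarrow>\<^sub>0 nat) \<Rightarrow> nat" where
  "mon_weight f m = (\<Sum>v \<in> vars_of m. Poly_Mapping.lookup m v * f v)"

lemma mon_weight_add: "mon_weight f (m + m') = mon_weight f m + mon_weight f m'"
proof -
  have *: "mon_weight f m'' = (\<Sum>v \<in> vars_of m \<union> vars_of m'. Poly_Mapping.lookup m'' v * f v)"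
    if "vars_of m'' \<subseteq> vars_of m \<union> vars_of m'" for m''
    unfolding mon_weight_def
    using that by (intro sum.mono_neutral_left) (auto simp: in_keys_iff)
  show ?thesis
    by (simp add: * vars_of_add lookup_add distrib_right sum.distrib)
qed

text \<open>
  The exponent vector of the image of a monomial when \<open>x\<^sub>v\<close> is mapped to the monomial in \<open>y\<^sub>0, y\<^sub>1, \<dots>\<close>
  whose exponent at \<open>y\<^sub>j\<close> is the value at \<open>v\<close> of the \<open>j\<close>-th function of the list. The target
  variables are numbered by natural numbers to have a linear order on exponent vectors, by which
  polynomials in them form an integral domain.
\<close>

definition multiweight :: "('v \<Rightarrow> nat) list \<Rightarrow> ('v \<Rightarrow>\<^sub>0 nat) \<Rightarrow> (nat \<Rightarrow>\<^sub>0 nat)" where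
  "multiweight fs m = (\<Sum>j < length fs. Poly_Mapping.single j (mon_weight (fs ! j) m))"

lemma multiweight_add: "multiweight fs (m + m') = multiweight fs m + multiweight fs m'"
  by (simp add: multiweight_def mon_weight_add single_add sum.distrib)

lemma multiweight_eq_iff:
  "multiweight fs m = multiweight fs m' \<longleftrightarrow> (\<forall>f \<in> set fs. mon_weight f m = mon_weight f m')"
proof -
  have "Poly_Mapping.lookup (multiweight fs m) j = (if j < length fs then mon_weight (fs ! j) m else 0)"
    for m :: "'a \<Rightarrow>\<^sub>0 nat" and j
    by (simp add: multiweight_def lookup_sum lookup_single when_def)
  then show ?thesis
    by (auto simp: poly_mapping_eq_iff fun_eq_iff all_set_conv_all_nth)
qed

text \<open>
  Variables outside \<open>T\<close> are mapped to zero, so a single monomial map accounts both for the killed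
  variables and for the binomial relations among the surviving ones.
\<close>

definition toric_term ::
  "'v set \<Rightarrow> ('v \<Rightarrow> nat) list \<Rightarrow> ('v \<Rightarrow>\<^sub>0 nat) \<Rightarrow> 'k \<Rightarrow> (nat \<Rightarrow>\<^sub>0 nat) \<Rightarrow>\<^sub>0 'k::field" where
  "toric_term T fs m c = (if vars_of m \<subseteq> T then Poly_Mapping.single (multiweight fs m) c else 0)"

definition toric_map ::
  "'v set \<Rightarrow> ('v \<Rightarrow> nat) list \<Rightarrow> ('v, 'k::field) mpoly \<Rightarrow> (nat \<Rightarrow>\<^sub>0 nat) \<Rightarrow>\<^sub>0 'k" where
  "toric_map T fs p = (\<Sum>m \<in> Poly_Mapping.keys p. toric_term T fs m (Poly_Mapping.lookup p m))"

lemma toric_map_superset: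
  assumes "finite A" "Poly_Mapping.keys p \<subseteq> A"
  shows "toric_map T fs p = (\<Sum>m \<in> A. toric_term T fs m (Poly_Mapping.lookup p m))"
  unfolding toric_map_def
  using assms by (intro sum.mono_neutral_left) (auto simp: in_keys_iff toric_term_def)

lemma toric_map_add:
  fixes p q :: "('v, 'k::field) mpoly"
  shows "toric_map T fs (p + q) = toric_map T fs p + toric_map T fs q"
proof -
  let ?A = "Poly_Mapping.keys p \<union> Poly_Mapping.keys q"
  have "toric_term T fs m (c + d) = toric_term T fs m c + toric_term T fs m d" for m :: "'v \<Rightarrow>\<^sub>0 nat" and c d :: 'k
    by (simp add: toric_term_def single_add)
  then show ?thesis
    using Poly_Mapping.keys_add[of p q]
    by (simp add: toric_map_superset[of ?A] lookup_add sum.distrib)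
qed

lemma toric_map_zero [simp]: "toric_map T fs 0 = 0"
  by (simp add: toric_map_def)

lemma toric_map_sum: "toric_map T fs (sum f A) = (\<Sum>x \<in> A. toric_map T fs (f x))"
  by (induction A rule: infinite_finite_induct) (simp_all add: toric_map_add)

lemma toric_map_uminus: "toric_map T fs (- p) = - toric_map T fs p"
  using toric_map_add[of T fs p "- p"] by (simp add: eq_neg_iff_add_eq_0 add.commute)

lemma toric_map_diff: "toric_map T fs (p - q) = toric_map T fs p - toric_map T fs q"
  using toric_map_add[of T fs p "- q"] by (simp add: toric_map_uminus)

lemma toric_map_single: "toric_map T fs (Poly_Mapping.single m c) = toric_term T fs m c"
  by (simp add: toric_map_superset[of "{m}"])

lemma toric_map_mult:
  fixes p q :: "('v, 'k::field) mpoly"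
  shows "toric_map T fs (p * q) = toric_map T fs p * toric_map T fs q"
proof -
  let ?s = "\<lambda>p m. Poly_Mapping.single m (Poly_Mapping.lookup p m)"
  have term_mult: "toric_term T fs (m + m') (c * d) = toric_term T fs m c * toric_term T fs m' d"
    for m m' :: "'v \<Rightarrow>\<^sub>0 nat" and c d :: 'k
    by (simp add: toric_term_def vars_of_add multiweight_add mult_single)
  have "p * q = (\<Sum>m \<in> Poly_Mapping.keys p. \<Sum>m' \<in> Poly_Mapping.keys q. ?s p m * ?s q m')"
    using sum_monomials[of p] sum_monomials[of q] by (simp flip: sum_product)
  then have "toric_map T fs (p * q) =
      (\<Sum>m \<in> Poly_Mapping.keys p. \<Sum>m' \<in> Poly_Mapping.keys q.
        toric_term T fs m (Poly_Mapping.lookup p m) * toric_term T fs m' (Poly_Mapping.lookup q m'))"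
    by (simp add: toric_map_sum mult_single toric_map_single term_mult)
  then show ?thesis
    by (simp add: toric_map_def sum_product)
qed

lemma toric_map_one: "toric_map T fs 1 = 1"
proof -
  have "multiweight fs 0 = 0"
    using multiweight_add[of fs 0 0] by simp
  then show ?thesis
    using toric_map_single[of T fs 0 1] by (simp add: toric_term_def)
qed

definition toric_ideal ::
  "'v set \<Rightarrow> 'v set \<Rightarrow> ('v \<Rightarrow> nat) list \<Rightarrow> ('v, 'k::field) mpoly set" where
  "toric_ideal V T fs = {p \<in> carrier (poly_ring_over V). toric_map T fs p = 0}"

text \<open>
  The monomial map is a ring homomorphism into a polynomial ring over a field, hence into a domain,
  and it maps 1 to 1.
\<close>

lemma toric_ideal_prime:
  "primeideal (toric_ideal V T fs :: ('v, 'k::field) mpoly set) (poly_ring_over V)"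
proof -
  interpret R: cring "poly_ring_over V :: ('v, 'k) mpoly ring" by (rule cring_poly_ring_over)
  let ?K = "toric_ideal V T fs :: ('v, 'k) mpoly set"
  have minus: "\<ominus>\<^bsub>poly_ring_over V\<^esub> p = - p" if "p \<in> carrier (poly_ring_over V)"
    for p :: "('v, 'k) mpoly"
  proof (rule R.minus_equality)
    show "- p \<in> carrier (poly_ring_over V)"
      using that by (simp add: poly_ring_over_simps keys.rep_eq)
  qed (use that in \<open>simp_all add: poly_ring_over_simps(3,5)\<close>)
  have "ideal ?K (poly_ring_over V)"
  proof (rule idealI)
    show "subgroup ?K (add_monoid (poly_ring_over V))"
    proof (rule R.add.subgroupI)
      show "?K \<noteq> {}"
        by (auto simp: toric_ideal_def poly_ring_over_simps(1) intro!: exI[of _ 0])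
    next
      fix p assume "p \<in> ?K"
      then show "\<ominus>\<^bsub>poly_ring_over V\<^esub> p \<in> ?K"
        using R.a_inv_closed[of p] by (simp add: toric_ideal_def minus toric_map_uminus)
    next
      fix p q :: "('v, 'k) mpoly" assume "p \<in> ?K" "q \<in> ?K"
      then show "p \<oplus>\<^bsub>poly_ring_over V\<^esub> q \<in> ?K"
        using R.a_closed[of p q]
        by (simp add: toric_ideal_def poly_ring_over_simps(3) toric_map_add)
    qed (auto simp: toric_ideal_def)
  next
    fix p q :: "('v, 'k) mpoly" assume "p \<in> ?K" "q \<in> carrier (poly_ring_over V)"
    then show "q \<otimes>\<^bsub>poly_ring_over V\<^esub> p \<in> ?K" "p \<otimes>\<^bsub>poly_ring_over V\<^esub> q \<in> ?K"
      using R.m_closed[of p q] R.m_closed[of q p]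
      by (simp_all add: toric_ideal_def poly_ring_over_simps(2) toric_map_mult)
  qed (rule R.ring_axioms)
  then show ?thesis
  proof (rule primeidealI)
    have "1 \<in> carrier (poly_ring_over V :: ('v, 'k) mpoly ring)" "1 \<notin> ?K"
      by (simp_all add: poly_ring_over_simps toric_ideal_def toric_map_one)
    then show "carrier (poly_ring_over V) \<noteq> ?K" by blast
  next
    fix p q :: "('v, 'k) mpoly"
    assume "p \<in> carrier (poly_ring_over V)" "q \<in> carrier (poly_ring_over V)"
      "p \<otimes>\<^bsub>poly_ring_over V\<^esub> q \<in> ?K"
    then show "p \<in> ?K \<or> q \<in> ?K"
      by (simp add: toric_ideal_def poly_ring_over_simps(2) toric_map_mult)
  qed (rule cring_poly_ring_over)
qed

definition mset_mon :: "'v multiset \<Rightarrow> ('v \<Rightarrow>\<^sub>0 nat)" where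
  "mset_mon M = (\<Sum>v \<in># M. Poly_Mapping.single v 1)"

lemma mset_mon_simps [simp]:
  "mset_mon {#} = 0" "mset_mon (add_mset v M) = Poly_Mapping.single v 1 + mset_mon M"
  "mset_mon (M + N) = mset_mon M + mset_mon N"
  by (simp_all add: mset_mon_def)

definition var_prod :: "'v multiset \<Rightarrow> ('v, 'k::field) mpoly" where
  "var_prod M = (\<Prod>v \<in># M. pvar v)"

lemma var_prod_single:
  "var_prod M = Poly_Mapping.single (mset_mon M) 1"
  by (induction M) (simp_all add: var_prod_def pvar_def mult_single)

lemma mon_weight_mset: "mon_weight f (mset_mon M) = (\<Sum>v \<in># M. f v)"
proof (induction M)
  case empty
  show ?case by (simp add: mon_weight_def)
next
  case (add v M)
  have "mon_weight f (Poly_Mapping.single v 1) = f v" by (simp add: mon_weight_def)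
  then show ?case using add by (simp add: mon_weight_add)
qed

lemma vars_of_mset: "vars_of (mset_mon M) = set_mset M"
  by (induction M) (simp_all add: vars_of_add)

text \<open>
  Exponent vectors are multisets of variables; the combinatorics of switching is done on the
  multisets.
\<close>

lemma monomial_as_mset:
  obtains M where "m = mset_mon M" "set_mset M = vars_of m"
proof -
  have rep: "mset_mon (replicate_mset k v) = Poly_Mapping.single v k" for k and v :: 'a
    by (induction k) (simp_all flip: single_add)
  have "mset_mon (\<Sum>v \<in> A. replicate_mset (Poly_Mapping.lookup m v) v) =
      (\<Sum>v \<in> A. Poly_Mapping.single v (Poly_Mapping.lookup m v))" if "finite A" for A
    using that by induction (simp_all add: rep del: One_nat_def)
  then have "mset_mon (\<Sum>v \<in> vars_of m. replicate_mset (Poly_Mapping.lookup m v) v) = m"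
    by (simp add: sum_monomials)
  then show ?thesis using that vars_of_mset by metis
qed

lemma toric_map_var_prod:
  "toric_map T fs (var_prod M :: ('v, 'k::field) mpoly) =
     toric_term T fs (mset_mon M) 1"
  by (simp add: var_prod_single toric_map_single)

lemma toric_binomial_iff:
  assumes "set_mset M \<subseteq> T" "set_mset N \<subseteq> T"
  shows "toric_map T fs (var_prod M - var_prod N :: ('v, 'k::field) mpoly) = 0 \<longleftrightarrow>
    (\<forall>f \<in> set fs. (\<Sum>v \<in># M. f v) = (\<Sum>v \<in># N. f v))"
proof -
  have "toric_map T fs (var_prod M - var_prod N :: ('v, 'k) mpoly) = 0 \<longleftrightarrow>
    Poly_Mapping.single (multiweight fs (mset_mon M)) (1::'k) =
    Poly_Mapping.single (multiweight fs (mset_mon N)) 1"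
    using assms by (simp add: toric_map_diff toric_map_var_prod toric_term_def vars_of_mset)
  also have "\<dots> \<longleftrightarrow> multiweight fs (mset_mon M) =
      multiweight fs (mset_mon N)"
    by (metis keys_single one_neq_zero singleton_inject)
  also have "\<dots> \<longleftrightarrow> (\<forall>f \<in> set fs. (\<Sum>v \<in># M. f v) = (\<Sum>v \<in># N. f v))"
    by (simp add: multiweight_eq_iff mon_weight_mset)
  finally show ?thesis .
qed

lemma toric_map_pvar_eq_0_iff:
  "toric_map T fs (pvar v :: ('v, 'k::field) mpoly) = 0 \<longleftrightarrow> v \<notin> T"
proof -
  have "Poly_Mapping.single w (1::'k) \<noteq> 0" for w :: "nat \<Rightarrow>\<^sub>0 nat"
    by (metis keys_single keys_zero insert_not_empty one_neq_zero)
  then show ?thesis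
    by (simp add: pvar_def toric_map_single toric_term_def)
qed

text \<open>
  The kernel of a monomial map is spanned by the monomials that are mapped to zero and by
  differences of monomials with the same image. Indeed, modulo these differences each surviving
  monomial may be replaced by a chosen representative of its weight, and then the coefficients of a
  representative add up to the coefficient of its image, which vanishes on the kernel.
\<close>

lemma toric_ideal_subset:
  fixes J :: "('v, 'k::field) mpoly set"
  assumes J: "ideal J (poly_ring_over V)"
    and vars: "\<And>v. v \<in> V - T \<Longrightarrow> pvar v \<in> J"
    and binomials: "\<And>M N. set_mset M \<subseteq> T \<Longrightarrow> set_mset N \<subseteq> T \<Longrightarrow>
      (\<And>f. f \<in> set fs \<Longrightarrow> (\<Sum>v \<in># M. f v) = (\<Sum>v \<in># N. f v)) \<Longrightarrow> var_prod M - var_prod N \<in> J"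
  shows "toric_ideal V T fs \<subseteq> J"
proof
  fix p :: "('v, 'k) mpoly" assume "p \<in> toric_ideal V T fs"
  then have p: "\<And>m. m \<in> Poly_Mapping.keys p \<Longrightarrow> vars_of m \<subseteq> V" and ker: "toric_map T fs p = 0"
    by (simp_all add: toric_ideal_def poly_ring_over_simps)
  let ?c = "Poly_Mapping.lookup p" and ?w = "multiweight fs"
  define A where "A = {m \<in> Poly_Mapping.keys p. vars_of m \<subseteq> T}"
  define rep where "rep w = (SOME m. m \<in> A \<and> ?w m = w)" for w
  have rep: "rep (?w m) \<in> A" "?w (rep (?w m)) = ?w m" if "m \<in> A" for m
    using someI[of "\<lambda>m'. m' \<in> A \<and> ?w m' = ?w m" m] that unfolding rep_def by auto
  have finA: "finite A" by (simp add: A_def)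
  have scale: "Poly_Mapping.single 0 c * q \<in> J" if "q \<in> J" for c q
    using poly_ideal_mult[OF J that single_in_poly_ring[of 0 V c]] by simp
  \<comment> \<open>terms that contain a killed variable\<close>
  have outside: "Poly_Mapping.single m (?c m) \<in> J" if m: "m \<in> Poly_Mapping.keys p - A" for m
  proof -
    obtain v where v: "v \<in> vars_of m" "v \<notin> T" using m by (auto simp: A_def)
    define m' where "m' = m - Poly_Mapping.single v 1"
    have m': "m = m' + Poly_Mapping.single v 1"
      using v(1) unfolding m'_def
      by (intro poly_mapping_eqI) (auto simp: lookup_add lookup_minus lookup_single when_def in_keys_iff)
    have "vars_of m' \<subseteq> V" using p[of m] m vars_of_add[of m' "Poly_Mapping.single v 1"] m' by auto
    moreover have "pvar v \<in> J" using v p[of m] m by (intro vars) auto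
    ultimately have "Poly_Mapping.single m' (?c m) * pvar v \<in> J"
      by (intro poly_ideal_mult[OF J] single_in_poly_ring)
    then show ?thesis using m' by (simp add: pvar_def mult_single)
  qed
  \<comment> \<open>replacing every monomial by the representative of its weight\<close>
  have inside: "Poly_Mapping.single m (?c m) - Poly_Mapping.single (rep (?w m)) (?c m) \<in> J"
    if m: "m \<in> A" for m
  proof -
    obtain M where M: "m = (mset_mon M)" "set_mset M = vars_of m"
      by (rule monomial_as_mset)
    obtain N where N: "rep (?w m) = (mset_mon N)"
        "set_mset N = vars_of (rep (?w m))"
      by (rule monomial_as_mset)
    have "(\<Sum>v \<in># M. f v) = (\<Sum>v \<in># N. f v)" if "f \<in> set fs" for f
      using rep(2)[OF m] that M(1) N(1) mon_weight_mset multiweight_eq_iff by metis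
    then have "var_prod M - var_prod N \<in> J"
      using M(2) N(2) m rep(1)[OF m] by (intro binomials) (auto simp: A_def)
    then have "Poly_Mapping.single 0 (?c m) * (var_prod M - var_prod N) \<in> J"
      by (rule scale)
    then show ?thesis
      by (simp add: var_prod_single right_diff_distrib mult_single flip: M(1) N(1))
  qed
  \<comment> \<open>the coefficients of each representative add up to a coefficient of the image of \<open>p\<close>\<close>
  have image: "toric_map T fs p = (\<Sum>m \<in> A. Poly_Mapping.single (?w m) (?c m))"
    unfolding toric_map_def A_def by (simp add: toric_term_def sum.inter_filter)
  have reps: "(\<Sum>m \<in> A. Poly_Mapping.single (rep (?w m)) (?c m)) = 0"
  proof -
    have "(\<Sum>m \<in> A. Poly_Mapping.single (rep (?w m)) (?c m)) =
        (\<Sum>w \<in> ?w ` A. \<Sum>m | m \<in> A \<and> ?w m = w. Poly_Mapping.single (rep w) (?c m))"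
      using finA by (subst sum.image_gen[of _ _ ?w]) (auto intro!: sum.cong)
    also have "\<dots> = (\<Sum>w \<in> ?w ` A. 0)"
    proof (rule sum.cong)
      fix w
      have "(\<Sum>m | m \<in> A \<and> ?w m = w. Poly_Mapping.single (rep w) (?c m)) =
          Poly_Mapping.single (rep w) (\<Sum>m | m \<in> A \<and> ?w m = w. ?c m)"
        by (rule poly_mapping_eqI) (simp add: lookup_sum lookup_single when_def)
      also have "(\<Sum>m | m \<in> A \<and> ?w m = w. ?c m) = Poly_Mapping.lookup (toric_map T fs p) w"
        unfolding image using finA by (simp add: lookup_sum lookup_single when_def sum.inter_filter)
      finally show "(\<Sum>m | m \<in> A \<and> ?w m = w. Poly_Mapping.single (rep w) (?c m)) = 0"
        using ker by simp
    qed simp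
    finally show ?thesis by simp
  qed
  have "p = (\<Sum>m \<in> Poly_Mapping.keys p - A. Poly_Mapping.single m (?c m)) +
      (\<Sum>m \<in> A. Poly_Mapping.single m (?c m))"
    using sum.subset_diff[of A "Poly_Mapping.keys p" "\<lambda>m. Poly_Mapping.single m (?c m)"]
      sum_monomials[of p] by (simp add: A_def)
  also have "(\<Sum>m \<in> A. Poly_Mapping.single m (?c m)) =
      (\<Sum>m \<in> A. Poly_Mapping.single m (?c m) - Poly_Mapping.single (rep (?w m)) (?c m))"
    by (simp add: sum_subtractf reps)
  finally have p_eq: "p = (\<Sum>m \<in> Poly_Mapping.keys p - A. Poly_Mapping.single m (?c m)) +
      (\<Sum>m \<in> A. Poly_Mapping.single m (?c m) - Poly_Mapping.single (rep (?w m)) (?c m))"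
    (is "_ = ?outside + ?inside") .
  have "?outside \<in> J" "?inside \<in> J"
    by (rule poly_ideal_sum[OF J outside], assumption) (rule poly_ideal_sum[OF J inside], assumption)
  then have "?outside + ?inside \<in> J" by (rule poly_ideal_add[OF J])
  then show "p \<in> J" by (simp flip: p_eq)
qed

section \<open>Connected components of switchable sets\<close>

lemma connected_inE:
  assumes "connected_in n S a b"
  obtains k :: nat and c :: "nat \<Rightarrow> index" where "c 0 = a" "c k = b" "\<And>j. j \<le> k \<Longrightarrow> c j \<in> S"
    "\<And>j. j \<in> {1..k} \<Longrightarrow> idist n (c (j - 1)) (c j) = 1"
  using assms[unfolded connected_in_def]
proof (elim exE conjE)
  fix k :: nat and c :: "nat \<Rightarrow> index" assume "c 0 = a" "c k = b" "\<forall>j \<le> k. c j \<in> S"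
    "\<forall>j \<in> {1..k}. idist n (c (j - 1)) (c j) = 1"
  then show thesis by (intro that[of c k]) auto
qed

text \<open>
  Paths as sequences are replaced by a reflexive transitive closure, which supplies induction on
  paths from either end.
\<close>

lemma connected_in_iff_rtrancl:
  "connected_in n S a b \<longleftrightarrow> a \<in> S \<and> (a, b) \<in> {(c, d). c \<in> S \<and> d \<in> S \<and> idist n c d = 1}\<^sup>*"
  (is "_ \<longleftrightarrow> _ \<and> _ \<in> ?E\<^sup>*")
proof
  assume "connected_in n S a b"
  then show "a \<in> S \<and> (a, b) \<in> ?E\<^sup>*"
  proof (rule connected_inE)
    fix k :: nat and c :: "nat \<Rightarrow> index"
    assume c: "c 0 = a" "c k = b" "\<And>j. j \<le> k \<Longrightarrow> c j \<in> S"
      "\<And>j. j \<in> {1..k} \<Longrightarrow> idist n (c (j - 1)) (c j) = 1"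
    have "(a, c j) \<in> ?E\<^sup>*" if "j \<le> k" for j
      using that
    proof (induction j)
      case (Suc j)
      then have "(c j, c (Suc j)) \<in> ?E"
        using c(3)[of j] c(3)[of "Suc j"] c(4)[of "Suc j"] by simp
      then show ?case using Suc by (meson Suc_leD rtrancl.rtrancl_into_rtrancl)
    qed (simp add: c(1))
    from this[of k] show "a \<in> S \<and> (a, b) \<in> ?E\<^sup>*"
      using c(1,2) c(3)[of 0] by simp
  qed
next
  assume "a \<in> S \<and> (a, b) \<in> ?E\<^sup>*"
  then have "(a, b) \<in> ?E\<^sup>*" "a \<in> S" by blast+
  then show "connected_in n S a b"
  proof (induction rule: rtrancl_induct)
    case base
    then show ?case
      unfolding connected_in_def by (intro exI[of _ 0] exI[of _ "\<lambda>_. a"]) simp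
  next
    case (step b d)
    from step.IH[OF step.prems] show ?case
    proof (rule connected_inE)
      fix k :: nat and c :: "nat \<Rightarrow> index"
      assume c: "c 0 = a" "c k = b" "\<And>j. j \<le> k \<Longrightarrow> c j \<in> S"
          "\<And>j. j \<in> {1..k} \<Longrightarrow> idist n (c (j - 1)) (c j) = 1"
      show "connected_in n S a d"
        unfolding connected_in_def
      proof (intro exI conjI allI impI ballI)
        show "(c(Suc k := d)) 0 = a" "(c(Suc k := d)) (Suc k) = d" using c by simp_all
        show "(c(Suc k := d)) j \<in> S" if "j \<le> Suc k" for j
          using that c(3) step.hyps by (auto simp: le_Suc_eq)
        show "idist n ((c(Suc k := d)) (j - 1)) ((c(Suc k := d)) j) = 1" if "j \<in> {1..Suc k}" for j
          using that c(2,4) step.hyps by (cases "j = Suc k") auto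
      qed
    qed
  qed
qed

lemma connected_in_mem: "connected_in n S a b \<Longrightarrow> a \<in> S \<and> b \<in> S"
proof (erule connected_inE)
  fix k :: nat and c :: "nat \<Rightarrow> index"
  assume "c 0 = a" "c k = b" "\<And>j. j \<le> k \<Longrightarrow> c j \<in> S"
  then show "a \<in> S \<and> b \<in> S" by (metis le0 le_refl)
qed

lemma connected_in_refl: "a \<in> S \<Longrightarrow> connected_in n S a a"
  by (simp add: connected_in_iff_rtrancl)

lemma connected_in_trans: "connected_in n S a b \<Longrightarrow> connected_in n S b c \<Longrightarrow> connected_in n S a c"
  unfolding connected_in_iff_rtrancl by auto

lemma connected_in_sym: "connected_in n S a b \<Longrightarrow> connected_in n S b a"
proof -
  have "idist n c d = idist n d c" for c d
    unfolding idist_def by (rule arg_cong[of _ _ card]) auto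
  then have "sym {(c, d). c \<in> S \<and> d \<in> S \<and> idist n c d = 1}"
    by (auto intro!: symI)
  then have "sym ({(c, d). c \<in> S \<and> d \<in> S \<and> idist n c d = 1}\<^sup>*)"
    by (rule sym_rtrancl)
  then show "connected_in n S a b \<Longrightarrow> connected_in n S b a"
    using connected_in_mem[of n S a b] unfolding connected_in_iff_rtrancl by (meson symD)
qed

lemma idist_le_1_cases:
  assumes "a \<in> indices n r" "b \<in> indices n r" "idist n a b = 1"
  obtains j where "j \<in> {1..n}" "b = a(j := b j)"
proof -
  obtain j where j: "{i \<in> {1..n}. a i \<noteq> b i} = {j}"
    using assms(3) unfolding idist_def by (auto simp: card_1_singleton_iff)
  have off: "a i = b i" if "i \<noteq> j" for i
  proof (cases "i \<in> {1..n}")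
    case True then show ?thesis using j that by blast
  next
    case False
    have "a i = undefined" "b i = undefined"
      using assms(1,2) False unfolding indices_def by (meson PiE_arb)+
    then show ?thesis by simp
  qed
  have "b i = (a(j := b j)) i" for i
    using off[of i] by (cases "i = j") simp_all
  then have "b = a(j := b j)" by (rule ext)
  moreover have "j \<in> {1..n}" using j by blast
  ultimately show ?thesis by (intro that)
qed

text \<open>
  The value \<open>s = 1\<close> is excluded because \<open>s\<close>-equivalence is trivial both for \<open>s = 0\<close> and for
  \<open>s = 1\<close>, while the arguments below separate a trivial equivalence from one under which at least
  two coordinates share a sum; the trivial case is represented by \<open>s = 0\<close>.
\<close>

locale switchable_set =
  fixes n s t :: nat and r :: "nat \<Rightarrow> nat" and S :: "index set"
  assumes t: "t \<in> {1..n}" and s_le: "s \<le> n" and s_neq: "s \<noteq> 1"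
    and r: "i \<in> {1..n} \<Longrightarrow> r i \<ge> 2"
    and S: "switchable n r s t S"
begin

abbreviation conn :: "index \<Rightarrow> index \<Rightarrow> bool" where "conn \<equiv> connected_in n S"

abbreviation head_sum :: "index \<Rightarrow> nat" where "head_sum a \<equiv> \<Sum>i = 1..s. a i"

lemma S_indices: "a \<in> S \<Longrightarrow> a \<in> indices n r"
  using S by (auto simp: switchable_def)

lemma S_range: "a \<in> S \<Longrightarrow> i \<in> {1..n} \<Longrightarrow> 1 \<le> a i \<and> a i \<le> r i"
  using S_indices by (auto simp: indices_def PiE_iff)

lemma S_equiv: "a \<in> S \<Longrightarrow> (a, b) \<in> s_equiv n r s \<Longrightarrow> b \<in> S"
  using S by (auto simp: switchable_def)

lemma S_eqI: "a \<in> S \<Longrightarrow> b \<in> S \<Longrightarrow> (\<And>i. i \<in> {1..n} \<Longrightarrow> a i = b i) \<Longrightarrow> a = b"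
  using S_indices unfolding indices_def by (meson PiE_ext)

lemma S_outside: "a \<in> S \<Longrightarrow> b \<in> S \<Longrightarrow> i \<notin> {1..n} \<Longrightarrow> a i = b i"
  using S_indices[of a] S_indices[of b] by (auto simp: indices_def PiE_iff extensional_def)

lemma conn_upd: "a \<in> S \<Longrightarrow> a(i := v) \<in> S \<Longrightarrow> conn a (a(i := v))"
proof (cases "i \<in> {1..n} \<and> a i \<noteq> v")
  case True
  assume a: "a \<in> S" "a(i := v) \<in> S"
  have "{j \<in> {1..n}. a j \<noteq> (a(i := v)) j} = {i}" using True by auto
  then have "idist n a (a(i := v)) = 1" by (simp add: idist_def)
  then show ?thesis using a by (auto simp: connected_in_iff_rtrancl)
next
  case False
  assume a: "a \<in> S" "a(i := v) \<in> S"
  then have "a(i := v) = a" using False S_outside[OF a, of i] by auto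
  then show ?thesis using a connected_in_refl by simp
qed

text \<open>
  If \<open>a\<close> and \<open>b\<close> differ in fewer than two positions, the switch yields \<open>a\<close> or \<open>b\<close>.
\<close>

lemma switch_adjacent:
  assumes "a \<in> S" "b \<in> S" "i \<in> {1..t}" and diff: "\<And>k. k \<noteq> i \<Longrightarrow> k \<noteq> j \<Longrightarrow> a k = b k"
  shows "a(i := b i) \<in> S"
proof -
  consider "a i = b i" | "a j = b j \<or> i = j" | "a i \<noteq> b i" "a j \<noteq> b j" "i \<noteq> j" by blast
  then show ?thesis
  proof cases
    case 1
    then have "a(i := b i) = a" by (metis fun_upd_triv)
    then show ?thesis using assms(1) by simp
  next
    case 2
    then have "a(i := b i) = b" using diff by fastforce
    then show ?thesis using assms(2) by simp
  next
    case 3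
    then have "{k \<in> {1..n}. a k \<noteq> b k} = {i, j}"
      using diff S_outside[OF assms(1,2)] by blast
    then have "idist n a b = 2" using 3 by (simp add: idist_def)
    then show ?thesis using S assms(1-3) unfolding switchable_def sw_def by blast
  qed
qed

lemma conn_two_positions:
  assumes "a \<in> S" "b \<in> S" "i \<in> {1..t}" "\<And>k. k \<noteq> i \<Longrightarrow> k \<noteq> j \<Longrightarrow> a k = b k"
  shows "conn a b"
proof -
  have m: "a(i := b i) \<in> S" by (rule switch_adjacent[OF assms])
  have "b = (a(i := b i))(j := b j)" using assms(4) by (auto simp: fun_eq_iff)
  then have "conn (a(i := b i)) b" using conn_upd[OF m, of j "b j"] assms(2) by simp
  then show ?thesis using conn_upd[OF assms(1) m] connected_in_trans by blast
qed

text \<open>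
  Membership of the switched index propagates backwards along a path that ends in \<open>b\<close>: if \<open>c\<close>
  is the successor of \<open>a\<close> on the path, then \<open>a\<close> and \<open>c(i := b i)\<close> differ at most at \<open>i\<close> and at
  the position of the step from \<open>a\<close> to \<open>c\<close>, so the defining property of switchable sets applies.
\<close>

lemma conn_switch:
  assumes "conn a b" "i \<in> {1..t}"
  shows "conn a (a(i := b i))"
proof -
  have b: "b \<in> S" using assms(1) connected_in_mem by blast
  have "(a, b) \<in> {(c, d). c \<in> S \<and> d \<in> S \<and> idist n c d = 1}\<^sup>*"
    using assms(1) by (simp add: connected_in_iff_rtrancl)
  then show ?thesis
  proof (induction rule: converse_rtrancl_induct)
    case base
    then show ?case using b connected_in_refl by simp
  next
    case (step a c)
    then have ac: "a \<in> S" "c \<in> S" "idist n a c = 1" by auto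
    have c': "c(i := b i) \<in> S" using step.IH connected_in_mem by blast
    obtain j where j: "j \<in> {1..n}" "c = a(j := c j)"
      using idist_le_1_cases[OF S_indices[OF ac(1)] S_indices[OF ac(2)] ac(3)] .
    have *: "a k = (c(i := b i)) k" if "k \<noteq> i" "k \<noteq> j" for k
      using that j(2) by (metis fun_upd_other)
    have "a(i := (c(i := b i)) i) \<in> S"
      by (rule switch_adjacent[OF ac(1) c' assms(2) *])
    then have "a(i := b i) \<in> S" by simp
    then show ?case using conn_upd ac by blast
  qed
qed

lemma head_sum_upd: "i \<in> {1..s} \<Longrightarrow> head_sum (a(i := v)) + a i = head_sum a + v"
  by (simp add: sum.remove[of _ i])

lemma unit_move_equiv:
  assumes "a \<in> S" "i \<in> {1..s}" "j \<in> {1..s}" "i \<noteq> j" "a i < r i" "1 < a j"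
  shows "(a, a(i := a i + 1, j := a j - 1)) \<in> s_equiv n r s"
proof -
  have "a j - 1 \<le> r j" using S_range[OF assms(1), of j] assms(3) s_le by auto
  then have "a(i := a i + 1, j := a j - 1) \<in> indices n r"
    using S_indices[OF assms(1)] assms s_le
    by (auto simp: indices_def PiE_iff extensional_def)
  moreover have "head_sum (a(i := a i + 1, j := a j - 1)) = head_sum a"
    using head_sum_upd[OF assms(2), of a "a i + 1"]
      head_sum_upd[OF assms(3), of "a(i := a i + 1)" "a j - 1"] assms by simp
  ultimately show ?thesis
    using S_indices[OF assms(1)] assms(2,3) by (simp add: s_equiv_def)
qed

text \<open>
  The two indices differ in two positions, neither of which need be switchable. Position 1 always is,
  since \<open>t \<ge> 1\<close>, so the unit is routed through position 1: it either gives up a unit first or, being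
  minimal, has room to take one because \<open>r 1 \<ge> 2\<close>.
\<close>

lemma conn_unit_move:
  assumes "a \<in> S" "i \<in> {1..s}" "j \<in> {1..s}" "i \<noteq> j" "a i < r i" "1 < a j"
  shows "conn a (a(i := a i + 1, j := a j - 1))"
proof -
  let ?b = "a(i := a i + 1, j := a j - 1)"
  have b: "?b \<in> S" using S_equiv unit_move_equiv assms by blast
  have one: "1 \<in> {1..t}" "1 \<in> {1..s}" using t assms(2) by auto
  have r1: "r 1 \<ge> 2" using r[of 1] t by simp
  consider "i = 1" | "j = 1" | "i \<noteq> 1" "j \<noteq> 1" "1 < a 1" | "i \<noteq> 1" "j \<noteq> 1" "a 1 < r 1"
    using r1 by linarith
  then show ?thesis
  proof cases
    case 1
    show ?thesis by (rule conn_two_positions[OF assms(1) b one(1), of j]) (use 1 in auto)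
  next
    case 2
    show ?thesis by (rule conn_two_positions[OF assms(1) b one(1), of i]) (use 2 in auto)
  next
    case 3
    let ?c = "a(i := a i + 1, 1 := a 1 - 1)"
    have c: "?c \<in> S" using S_equiv[OF assms(1) unit_move_equiv] assms one 3 by blast
    have "conn a ?c" by (rule conn_two_positions[OF assms(1) c one(1), of i]) auto
    moreover have "conn ?c ?b" by (rule conn_two_positions[OF c b one(1), of j]) (use 3 in auto)
    ultimately show ?thesis by (rule connected_in_trans)
  next
    case 4
    let ?c = "a(1 := a 1 + 1, j := a j - 1)"
    have c: "?c \<in> S" using S_equiv[OF assms(1) unit_move_equiv] assms one 4 by metis
    have "conn a ?c" by (rule conn_two_positions[OF assms(1) c one(1), of j]) auto
    moreover have "conn ?c ?b" by (rule conn_two_positions[OF c b one(1), of i]) (use 4 in auto)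
    ultimately show ?thesis by (rule connected_in_trans)
  qed
qed

text \<open>
  Connected components are therefore unions of \<open>s\<close>-equivalence classes, so that distinct components
  involve disjoint sets of variables and a component can be read off from a variable. The proof moves
  units from positions where \<open>a\<close> is too large to positions where it is too small.
\<close>

lemma equiv_conn:
  assumes "a \<in> S" "(a, b) \<in> s_equiv n r s"
  shows "conn a b"
  using assms
proof (induction "\<Sum>i = 1..s. b i - a i" arbitrary: a rule: less_induct)
  case less
  have b: "b \<in> S" using S_equiv less.prems by blast
  have sum_eq: "head_sum a = head_sum b" and tail: "\<And>i. i \<in> {s+1..n} \<Longrightarrow> a i = b i"
    using less.prems(2) by (auto simp: s_equiv_def)
  show ?case
  proof (cases "a = b")
    case True then show ?thesis using b connected_in_refl by simp
  next
    case False
    have neq: "\<not> (\<forall>i \<in> {1..s}. a i = b i)"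
    proof
      assume "\<forall>i \<in> {1..s}. a i = b i"
      then have "a = b"
        using tail by (intro S_eqI[OF less.prems(1) b]) (auto simp: not_less_eq_eq)
      then show False using False by simp
    qed
    have "\<exists>i \<in> {1..s}. a i < b i"
    proof (rule ccontr)
      assume "\<not> (\<exists>i \<in> {1..s}. a i < b i)"
      then have "\<forall>i \<in> {1..s}. b i = a i"
        using sum_mono_inv[of b "{1..s}" a] sum_eq by (metis finite_atLeastAtMost not_less)
      then show False using neq by simp
    qed
    moreover have "\<exists>j \<in> {1..s}. b j < a j"
    proof (rule ccontr)
      assume "\<not> (\<exists>j \<in> {1..s}. b j < a j)"
      then have "\<forall>j \<in> {1..s}. a j = b j"
        using sum_mono_inv[of a "{1..s}" b] sum_eq by (metis finite_atLeastAtMost not_less)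
      then show False using neq by simp
    qed
    ultimately obtain i j where i: "i \<in> {1..s}" "a i < b i" and j: "j \<in> {1..s}" "b j < a j"
      by blast
    have ij: "i \<noteq> j" using i j by auto
    have ai: "a i < r i" using i S_range[OF b, of i] s_le by auto
    have aj: "1 < a j" using j S_range[OF b, of j] s_le by auto
    let ?a = "a(i := a i + 1, j := a j - 1)"
    have eq: "(a, ?a) \<in> s_equiv n r s"
      using unit_move_equiv[OF less.prems(1) i(1) j(1) ij ai aj] .
    have "(\<Sum>i = 1..s. b i - ?a i) < (\<Sum>i = 1..s. b i - a i)"
      using i j by (intro sum_strict_mono_ex1) auto
    moreover have "?a \<in> S" using S_equiv[OF less.prems(1) eq] .
    moreover have "(?a, b) \<in> s_equiv n r s"
      using eq less.prems(2) by (auto simp: s_equiv_def)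
    ultimately have "conn ?a b" by (rule less.hyps)
    then show ?thesis
      using conn_unit_move[OF less.prems(1) i(1) j(1) ij ai aj] connected_in_trans by blast
  qed
qed

section \<open>Switching multisets of indices\<close>

text \<open>
  A multiset of indices stands for the product of the corresponding variables; the first
  rule subtracts a monomial multiple of the generator \<open>f\<^bsub>i,a,b\<^esub>\<close>, the second one changes the
  representative of a variable. Monomials related in this way are congruent modulo \<open>P\<^sub>S\<close>.
\<close>

inductive switch_step :: "index multiset \<Rightarrow> index multiset \<Rightarrow> bool" where
  switch: "conn a b \<Longrightarrow> i \<in> {1..t} \<Longrightarrow>
    switch_step (add_mset a (add_mset b M)) (add_mset (sw i a b) (add_mset (sw i b a) M))"
| replace: "a \<in> S \<Longrightarrow> (a, b) \<in> s_equiv n r s \<Longrightarrow> switch_step (add_mset a M) (add_mset b M)"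

abbreviation switches_to :: "index multiset \<Rightarrow> index multiset \<Rightarrow> bool" (infix "\<leadsto>" 50) where
  "M \<leadsto> N \<equiv> switch_step\<^sup>*\<^sup>* M N"

lemma switch_step_plus: "switch_step M N \<Longrightarrow> switch_step (M + K) (N + K)"
  by (induction rule: switch_step.induct) (simp_all add: switch_step.intros)

lemma switches_to_plus: "M \<leadsto> N \<Longrightarrow> M + K \<leadsto> N + K"
  by (induction rule: rtranclp_induct) (auto intro: rtranclp.rtrancl_into_rtrancl switch_step_plus)

lemma conn_sw:
  assumes "conn a b" "i \<in> {1..t}"
  shows "conn a (sw i a b)" "conn a (sw i b a)"
  using conn_switch[OF assms] connected_in_trans[OF assms(1) conn_switch[OF connected_in_sym[OF assms(1)] assms(2)]]
  by (simp_all add: sw_def)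

lemma switches_to_subset: "M \<leadsto> N \<Longrightarrow> set_mset M \<subseteq> S \<Longrightarrow> set_mset N \<subseteq> S"
proof (induction rule: rtranclp_induct)
  case (step M' N)
  have "set_mset M' \<subseteq> S" using step by blast
  with step(2) show ?case
  proof cases
    case (switch a b i K)
    then have "sw i a b \<in> S" "sw i b a \<in> S"
      using conn_sw connected_in_mem by blast+
    then show ?thesis using switch \<open>set_mset M' \<subseteq> S\<close> by auto
  next
    case (replace a b K)
    then show ?thesis using S_equiv \<open>set_mset M' \<subseteq> S\<close> by auto
  qed
qed

definition switch_invariant :: "(index \<Rightarrow> nat) \<Rightarrow> bool" where
  "switch_invariant f \<longleftrightarrow>
    (\<forall>a b i. conn a b \<longrightarrow> i \<in> {1..t} \<longrightarrow> f a + f b = f (sw i a b) + f (sw i b a)) \<and>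
    (\<forall>a b. a \<in> S \<longrightarrow> (a, b) \<in> s_equiv n r s \<longrightarrow> f a = f b)"

lemma switch_invariant_sum:
  assumes "switch_invariant f" "M \<leadsto> N"
  shows "(\<Sum>a \<in># M. f a) = (\<Sum>a \<in># N. f a)"
  using assms(2)
proof (induction rule: rtranclp_induct)
  case (step M' N)
  from step(2) have "(\<Sum>a \<in># M'. f a) = (\<Sum>a \<in># N. f a)"
  proof cases
    case (switch a b i K)
    then have "f a + f b = f (sw i a b) + f (sw i b a)"
      using assms(1) by (simp add: switch_invariant_def)
    then show ?thesis using switch by simp
  next
    case (replace a b K)
    then show ?thesis using assms(1) by (simp add: switch_invariant_def)
  qed
  then show ?case using step by simp
qed simp

definition below_excess :: "index \<Rightarrow> index \<Rightarrow> nat" where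
  "below_excess c a = (if conn a c then head_sum a - s else 0)"

definition above_excess :: "index \<Rightarrow> index \<Rightarrow> nat" where
  "above_excess c a = (if conn a c then head_sum r - head_sum a else 0)"

definition agrees_on :: "nat set \<Rightarrow> index \<Rightarrow> index \<Rightarrow> nat" where
  "agrees_on I c a = of_bool (conn a c \<and> (\<forall>i \<in> I. a i = c i))"

text \<open>
  The quantities preserved by switching inside the component of an index \<open>c\<close>. Each function is to be
  summed over the entries of a multiset, which yields: the total excess of the sums of the first \<open>s\<close>
  coordinates over their least value \<open>s\<close>, their total shortfall from the largest value, and the number
  of entries that agree with \<open>c\<close> in one position between \<open>s\<close> and \<open>t\<close>, or in all positions beyond
  both \<open>s\<close> and \<open>t\<close>. Excess and shortfall together keep the total sum under control without counting
  the entries of a component, and as nonnegative functions they point to an entry that can still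
  give up or take a unit.
\<close>

definition invariants :: "(index \<Rightarrow> nat) set" where
  "invariants = (\<Union>c \<in> S. {below_excess c, above_excess c, agrees_on {max s t + 1..n} c} \<union>
     (\<lambda>i. agrees_on {i} c) ` {s+1..t})"

lemma finite_S: "finite S"
proof -
  have "finite (indices n r)" unfolding indices_def by (intro finite_PiE) auto
  then show ?thesis using S_indices by (meson finite_subset subsetI)
qed

lemma finite_invariants: "finite invariants"
  by (simp add: invariants_def finite_S)

lemma head_sum_bounds: "a \<in> S \<Longrightarrow> s \<le> head_sum a \<and> head_sum a \<le> head_sum r"
proof
  assume a: "a \<in> S"
  have "(\<Sum>i = 1..s. 1) \<le> head_sum a"
    using S_range[OF a] s_le by (intro sum_mono) auto
  then show "s \<le> head_sum a" by simp
  show "head_sum a \<le> head_sum r"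
    using S_range[OF a] s_le by (intro sum_mono) auto
qed

lemma head_sum_sw: "head_sum (sw i a b) + head_sum (sw i b a) = head_sum a + head_sum b"
proof (cases "i \<in> {1..s}")
  case True
  then show ?thesis
    using head_sum_upd[OF True, of a "b i"] head_sum_upd[OF True, of b "a i"] by (simp add: sw_def)
next
  case False
  then have "head_sum (sw i a b) = head_sum a" "head_sum (sw i b a) = head_sum b"
    unfolding sw_def by (auto intro!: sum.cong)
  then show ?thesis by simp
qed

lemma invariants_cases:
  assumes "f \<in> invariants"
  obtains c where "f = below_excess c" | c where "f = above_excess c"
  | c I where "f = agrees_on I c" "I \<subseteq> {s+1..n}" "\<And>i. i \<in> {1..t} \<Longrightarrow> i \<in> I \<Longrightarrow> I = {i}"
proof -
  consider c where "f = below_excess c" | c where "f = above_excess c"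
    | c where "f = agrees_on {max s t + 1..n} c" | c i where "i \<in> {s+1..t}" "f = agrees_on {i} c"
    using assms unfolding invariants_def by blast
  then show ?thesis
  proof cases
    case (3 c)
    then show ?thesis by (rule that(3)) auto
  next
    case (4 c i)
    then show ?thesis using t by (intro that(3)[of "{i}" c]) auto
  qed (use that in blast)+
qed

lemma invariants_invariant:
  assumes "f \<in> invariants"
  shows "switch_invariant f"
  unfolding switch_invariant_def
proof (intro conjI allI impI)
  fix a b assume a: "a \<in> S" and ab: "(a, b) \<in> s_equiv n r s"
  have "conn a b" using equiv_conn[OF a ab] .
  then have conn: "conn b c \<longleftrightarrow> conn a c" for c
    using connected_in_trans connected_in_sym by blast
  have sum_eq: "head_sum b = head_sum a" and tail: "\<And>i. i \<in> {s+1..n} \<Longrightarrow> b i = a i"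
    using ab by (auto simp: s_equiv_def)
  from assms show "f a = f b"
  proof (cases rule: invariants_cases)
    case (3 c I)
    then have "\<forall>i \<in> I. b i = a i" using tail by blast
    then show ?thesis using 3(1) by (simp add: agrees_on_def conn)
  qed (use sum_eq in \<open>simp_all add: below_excess_def above_excess_def conn\<close>)
next
  fix a b i assume ab: "conn a b" and i: "i \<in> {1..t}"
  let ?a = "sw i a b" and ?b = "sw i b a"
  have conn: "conn b c \<longleftrightarrow> conn a c" "conn ?a c \<longleftrightarrow> conn a c" "conn ?b c \<longleftrightarrow> conn a c" for c
    using ab conn_sw[OF ab i] connected_in_trans connected_in_sym by blast+
  have mem: "a \<in> S" "b \<in> S" "?a \<in> S" "?b \<in> S"
    using ab conn_sw[OF ab i] connected_in_mem by blast+
  from assms show "f a + f b = f ?a + f ?b"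
  proof (cases rule: invariants_cases)
    case (1 c)
    then show ?thesis
      using head_sum_sw[of i a b] mem[THEN head_sum_bounds] by (auto simp: below_excess_def conn)
  next
    case (2 c)
    then show ?thesis
      using head_sum_sw[of i a b] mem[THEN head_sum_bounds] by (auto simp: above_excess_def conn)
  next
    case (3 c I)
    show ?thesis
    proof (cases "i \<in> I")
      case True
      then have "I = {i}" using 3(3) i by blast
      moreover have "?a i = b i" "?b i = a i" by (simp_all add: sw_def)
      ultimately show ?thesis using 3(1) by (simp add: agrees_on_def conn)
    next
      case False
      then have "(\<forall>j \<in> I. sw i x y j = c j) \<longleftrightarrow> (\<forall>j \<in> I. x j = c j)" for x y
        unfolding sw_def by (metis fun_upd_other)
      then show ?thesis using 3(1) by (simp add: agrees_on_def conn)
    qed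
  qed
qed

section \<open>Completeness of the switching invariants\<close>

text \<open>
  If no position between 2 and \<open>s\<close> has room for another unit, then position 1 has, since the sum is not
  maximal; a unit moved there from position 2 leaves room behind.
\<close>

lemma move_first_to_tail:
  assumes a: "a \<in> S" and s: "2 \<le> s" and less: "head_sum a < head_sum r"
  obtains a' i where "(a, a') \<in> s_equiv n r s" "i \<in> {2..s}" "a' i < r i"
proof (cases "\<exists>i \<in> {2..s}. a i < r i")
  case True
  moreover have "(a, a) \<in> s_equiv n r s" using S_indices[OF a] by (simp add: s_equiv_def)
  ultimately show ?thesis using that by blast
next
  case False
  then have full: "a i = r i" if "i \<in> {2..s}" for i
    using that S_range[OF a, of i] s_le by (simp add: not_less le_antisym)
  have "a 1 < r 1"
  proof (rule ccontr)
    assume "\<not> a 1 < r 1"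
    then have "r i \<le> a i" if "i \<in> {1..s}" for i
      using full[of i] that by (cases "i = 1") auto
    then have "head_sum r \<le> head_sum a" by (rule sum_mono)
    then show False using less by simp
  qed
  moreover have "2 \<le> r 2" using r[of 2] s s_le by simp
  ultimately have "(a, a(1 := a 1 + 1, 2 := a 2 - 1)) \<in> s_equiv n r s"
    using s full[of 2] by (intro unit_move_equiv[OF a]) auto
  then show ?thesis
    using that[of "a(1 := a 1 + 1, 2 := a 2 - 1)" 2] s full[of 2] \<open>2 \<le> r 2\<close> by simp
qed

lemma move_tail_to_first:
  assumes b: "b \<in> S" and s: "2 \<le> s" and less: "s < head_sum b"
  obtains b' where "(b, b') \<in> s_equiv n r s" "1 < b' 1"
proof (cases "1 < b 1")
  case True
  moreover have "(b, b) \<in> s_equiv n r s" using S_indices[OF b] by (simp add: s_equiv_def)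
  ultimately show ?thesis using that by blast
next
  case False
  then have b1: "b 1 = 1" using S_range[OF b, of 1] t by simp
  have "\<exists>j \<in> {1..s}. 1 < b j"
  proof (rule ccontr)
    assume "\<not> (\<exists>j \<in> {1..s}. 1 < b j)"
    then have "head_sum b \<le> (\<Sum>i = 1..s. 1)" by (intro sum_mono) (meson not_less)
    then show False using less by simp
  qed
  then obtain j where j: "j \<in> {1..s}" "1 < b j" by blast
  have "(b, b(1 := b 1 + 1, j := b j - 1)) \<in> s_equiv n r s"
    using s j b1 r[of 1] t by (intro unit_move_equiv[OF b]) auto
  moreover have "j \<noteq> 1" using j b1 by auto
  ultimately show ?thesis
    using that[of "b(1 := b 1 + 1, j := b j - 1)"] b1 by simp
qed

text \<open>
  Connected indices can trade one unit of their sums as far as the bounds on the sums permit, although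
  a single switch at position 1 exchanges whole coordinates. The trade is a switch that is undone after a change of
  representatives: after exchanging the first coordinates, one unit of the new first coordinate of
  \<open>a\<close> is moved to a position \<open>i \<le> s\<close>, which does not change the class; exchanging the first
  coordinates again restores them up to one unit, which has stayed behind in position \<open>i\<close>. This needs
  room in position \<open>i\<close> of \<open>a\<close> and a first coordinate of \<open>b\<close> above 1, which suitable
  representatives provide.
\<close>

lemma transfer_unit:
  assumes ab: "conn a b" and s: "2 \<le> s" and less: "head_sum a < head_sum r" "s < head_sum b"
  obtains a' b' where "{#a, b#} \<leadsto> {#a', b'#}" "conn a a'" "conn b b'"
    "\<And>i. i \<in> {s+1..n} \<Longrightarrow> a' i = a i" "\<And>i. i \<in> {s+1..n} \<Longrightarrow> b' i = b i"
    "head_sum a' = head_sum a + 1" "head_sum b' + 1 = head_sum b"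
proof -
  have mem: "a \<in> S" "b \<in> S" using ab connected_in_mem by blast+
  obtain c i where c: "(a, c) \<in> s_equiv n r s" "i \<in> {2..s}" "c i < r i"
    using move_first_to_tail[OF mem(1) s less(1)] .
  obtain d where d: "(b, d) \<in> s_equiv n r s" "1 < d 1"
    using move_tail_to_first[OF mem(2) s less(2)] .
  have one: "1 \<in> {1..t}" "1 \<in> {1..s}" and i: "i \<in> {1..s}" "i \<noteq> 1" using t s c(2) by auto
  have ac: "conn a c" and bd: "conn b d" using equiv_conn mem c(1) d(1) by blast+
  have cd: "conn c d" using ac bd ab connected_in_trans connected_in_sym by blast
  let ?p = "c(1 := d 1)" and ?q = "d(1 := c 1)"
  let ?p' = "c(i := c i + 1, 1 := d 1 - 1)"
  have pq: "sw 1 c d = ?p" "sw 1 d c = ?q" by (simp_all add: sw_def)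
  have cp: "conn c ?p" and cq: "conn c ?q" using conn_sw[OF cd one(1)] unfolding pq .
  have p: "?p \<in> S" using cp connected_in_mem by blast
  have "?p(i := ?p i + 1, 1 := ?p 1 - 1) = ?p'" using i by (auto simp: fun_eq_iff)
  then have pp': "(?p, ?p') \<in> s_equiv n r s"
    using unit_move_equiv[OF p i(1) one(2)] i c(3) d(2) by simp
  have cp': "conn c ?p'" using equiv_conn[OF p pp'] cp connected_in_trans by blast
  then have p'q: "conn ?p' ?q" using cq connected_in_trans connected_in_sym by blast
  let ?a = "c(i := c i + 1)" and ?b = "d(1 := d 1 - 1)"
  have sw': "sw 1 ?p' ?q = ?a" "sw 1 ?q ?p' = ?b" using i by (auto simp: sw_def fun_eq_iff)
  have "switch_step {#a, b#} {#c, b#}"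
    using switch_step.replace[OF mem(1) c(1), of "{#b#}"] by simp
  moreover have "switch_step {#c, b#} {#c, d#}"
    using switch_step.replace[OF mem(2) d(1), of "{#c#}"] by (simp add: add_mset_commute)
  moreover have "switch_step {#c, d#} {#?p, ?q#}"
    using switch_step.switch[OF cd one(1), of "{#}"] unfolding pq .
  moreover have "switch_step {#?p, ?q#} {#?p', ?q#}"
    using switch_step.replace[OF p pp', of "{#?q#}"] by simp
  moreover have "switch_step {#?p', ?q#} {#?a, ?b#}"
    using switch_step.switch[OF p'q one(1), of "{#}"] unfolding sw' .
  ultimately have steps: "{#a, b#} \<leadsto> {#?a, ?b#}"
    by (meson converse_rtranclp_into_rtranclp rtranclp.rtrancl_refl)
  have conn': "conn ?p' ?a" "conn ?p' ?b" using conn_sw[OF p'q one(1)] unfolding sw' .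
  show ?thesis
  proof (rule that[OF steps])
    show "conn a ?a" using ac cp' conn'(1) connected_in_trans by blast
    show "conn b ?b" using bd cd cp' conn'(2) connected_in_trans connected_in_sym by blast
    show "?a k = a k" if "k \<in> {s+1..n}" for k
      using that c(1) i by (auto simp: s_equiv_def)
    show "?b k = b k" if "k \<in> {s+1..n}" for k
      using that d(1) one by (auto simp: s_equiv_def)
    show "head_sum ?a = head_sum a + 1"
      using head_sum_upd[OF i(1), of c "c i + 1"] c(1) by (simp add: s_equiv_def)
    show "head_sum ?b + 1 = head_sum b"
      using head_sum_upd[OF one(2), of d "d 1 - 1"] d by (simp add: s_equiv_def)
  qed
qed

lemma sum_mset_positive_entry: "(\<Sum>a \<in># M. f a) \<noteq> (0::nat) \<Longrightarrow> \<exists>e. e \<in># M \<and> 0 < f e"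
  by (induction M) auto

text \<open>
  How invariants are used: if one of them is positive at the wanted entry \<open>b\<close>, it is positive at
  some entry that is currently present.
\<close>

lemma invariant_positive:
  assumes "f \<in> invariants" "M \<leadsto> M'"
    and "(\<Sum>a \<in># M. f a) = (\<Sum>a \<in># add_mset b N. f a)" "f b > 0"
  obtains e where "e \<in># M'" "f e > 0"
proof -
  have "(\<Sum>a \<in># M'. f a) = f b + (\<Sum>a \<in># N. f a)"
    using switch_invariant_sum[OF invariants_invariant[OF assms(1)] assms(2)] assms(3) by simp
  then have "(\<Sum>a \<in># M'. f a) \<noteq> 0" using assms(4) by linarith
  from sum_mset_positive_entry[OF this] show ?thesis using that by blast
qed

lemma agrees_on_self: "b \<in> S \<Longrightarrow> agrees_on I b b > 0"
  by (simp add: agrees_on_def connected_in_refl)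

text \<open>
  One entry is made to agree with the target \<open>b\<close> in the positions beyond \<open>s\<close>. The positions beyond
  both \<open>s\<close> and \<open>t\<close> cannot be changed by switching, so an entry that is right there is picked first;
  each position in \<open>I\<close> is then corrected by one switch with an entry that carries the wanted value.
\<close>

lemma match_entries:
  assumes M: "set_mset M \<subseteq> S" and b: "b \<in> S"
    and inv: "\<And>f. f \<in> invariants \<Longrightarrow> (\<Sum>a \<in># M. f a) = (\<Sum>a \<in># add_mset b N. f a)"
    and I: "I \<subseteq> {s+1..t}"
  shows "\<exists>a K. M \<leadsto> add_mset a K \<and> conn a b \<and> (\<forall>i \<in> I \<union> {max s t + 1..n}. a i = b i)"
proof -
  have "finite I" using I finite_subset by blast
  then show ?thesis using I
  proof (induction I)
    case empty
    have f: "agrees_on {max s t + 1..n} b \<in> invariants" using b by (auto simp: invariants_def)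
    obtain a where a: "a \<in># M" "agrees_on {max s t + 1..n} b a > 0"
      by (rule invariant_positive[OF f, OF rtranclp.rtrancl_refl inv[OF f] agrees_on_self[OF b]])
    obtain K where "M = add_mset a K" using multi_member_split[OF a(1)] ..
    then have "M \<leadsto> add_mset a K" by simp
    moreover have "conn a b \<and> (\<forall>i \<in> {} \<union> {max s t + 1..n}. a i = b i)"
      using a(2) by (simp add: agrees_on_def split: if_splits)
    ultimately show ?case by blast
  next
    case (insert i I)
    then obtain a K where aK: "M \<leadsto> add_mset a K" "conn a b"
        "\<forall>j \<in> I \<union> {max s t + 1..n}. a j = b j"
      by blast
    have f: "agrees_on {i} b \<in> invariants" using b insert.prems unfolding invariants_def by blast
    obtain e where e: "e \<in># add_mset a K" "agrees_on {i} b e > 0"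
      by (rule invariant_positive[OF f, OF aK(1) inv[OF f] agrees_on_self[OF b]])
    have eb: "conn e b" "e i = b i" using e(2) by (simp_all add: agrees_on_def split: if_splits)
    show ?case
    proof (cases "e = a")
      case True
      then show ?thesis using aK eb by blast
    next
      case False
      then have "e \<in># K" using e(1) by simp
      then obtain L where L: "K = add_mset e L" using multi_member_split by metis
      have ae: "conn a e" using aK(2) eb(1) connected_in_trans connected_in_sym by blast
      have i: "i \<in> {1..t}" using insert.prems by auto
      have "M \<leadsto> add_mset (sw i a e) (add_mset (sw i e a) L)"
        using aK(1) switch_step.switch[OF ae i, of L] unfolding L by (rule rtranclp.rtrancl_into_rtrancl)
      moreover have "conn (sw i a e) b"
        using conn_sw(1)[OF ae i] aK(2) connected_in_trans connected_in_sym by blast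
      moreover have "sw i a e j = b j" if "j \<in> insert i I \<union> {max s t + 1..n}" for j
        using that aK(3) eb(2) by (cases "j = i") (auto simp: sw_def)
      ultimately show ?thesis by blast
    qed
  qed
qed

text \<open>
  The remaining discrepancy is the sum of the first \<open>s\<close> coordinates. It is closed one unit at a time
  with the help of another entry of the component. Such an entry exists since the invariant total of
  excesses (or shortfalls) exceeds the contribution of the entry under construction.
\<close>

lemma match_head_sum:
  assumes b: "b \<in> S"
    and inv: "\<And>f. f \<in> invariants \<Longrightarrow> (\<Sum>a \<in># M. f a) = (\<Sum>a \<in># add_mset b N. f a)"
    and "M \<leadsto> add_mset a K" "conn a b" "\<And>i. i \<in> {s+1..n} \<Longrightarrow> a i = b i"
  shows "\<exists>a K. M \<leadsto> add_mset a K \<and> a \<in> S \<and> (a, b) \<in> s_equiv n r s"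
  using assms(3-5)
proof (induction "(head_sum a - head_sum b) + (head_sum b - head_sum a)" arbitrary: a K rule: less_induct)
  case less
  have a: "a \<in> S" using less.prems(2) connected_in_mem by blast
  have bounds: "s \<le> head_sum a" "head_sum a \<le> head_sum r" "s \<le> head_sum b" "head_sum b \<le> head_sum r"
    using head_sum_bounds a b by auto
  \<comment> \<open>a nonnegative invariant that is larger at \<open>b\<close> than at \<open>a\<close> is positive on some other entry\<close>
  have partner: "\<exists>e L. K = add_mset e L \<and> 0 < f e" if f: "f \<in> invariants" "f a < f b" for f
  proof -
    have "f a + (\<Sum>e \<in># K. f e) = f b + (\<Sum>e \<in># N. f e)"
      using switch_invariant_sum[OF invariants_invariant[OF f(1)] less.prems(1)] inv[OF f(1)] by simp
    then have "(\<Sum>e \<in># K. f e) \<noteq> 0" using f(2) by linarith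
    then obtain e where e: "e \<in># K" "f e > 0" using sum_mset_positive_entry by blast
    show ?thesis using multi_member_split[OF e(1)] e(2) by blast
  qed
  consider "head_sum a = head_sum b" | "head_sum a < head_sum b" | "head_sum b < head_sum a" by linarith
  then show ?case
  proof cases
    case 1
    then have "(a, b) \<in> s_equiv n r s"
      using less.prems(3) S_indices a b by (simp add: s_equiv_def)
    then show ?thesis using less.prems(1) a by blast
  next
    case 2
    have f: "below_excess b \<in> invariants" "below_excess b a < below_excess b b"
      using b 2 less.prems(2) bounds connected_in_refl[OF b] by (auto simp: invariants_def below_excess_def)
    obtain e L where e: "K = add_mset e L" "below_excess b e > 0" using partner[OF f] by blast
    then have eb: "conn e b" "s < head_sum e" by (auto simp: below_excess_def split: if_splits)
    have ae: "conn a e" using eb less.prems(2) connected_in_trans connected_in_sym by blast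
    have "s \<noteq> 0" using 2 by (cases s) auto
    then have s2: "2 \<le> s" using s_neq by simp
    have "head_sum a < head_sum r" using 2 bounds by simp
    then obtain a' e' where a': "{#a, e#} \<leadsto> {#a', e'#}" "conn a a'"
        "\<And>i. i \<in> {s+1..n} \<Longrightarrow> a' i = a i" "head_sum a' = head_sum a + 1"
      using transfer_unit[OF ae s2 _ eb(2)] by metis
    have "M \<leadsto> add_mset a' (add_mset e' L)"
      using less.prems(1) switches_to_plus[OF a'(1), of L] e(1) by simp
    moreover have "conn a' b" using a'(2) less.prems(2) connected_in_trans connected_in_sym by blast
    moreover have "(head_sum a' - head_sum b) + (head_sum b - head_sum a') <
        (head_sum a - head_sum b) + (head_sum b - head_sum a)" using a'(4) 2 by simp
    ultimately show ?thesis using less.hyps a'(3) less.prems(3) by metis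
  next
    case 3
    have f: "above_excess b \<in> invariants" "above_excess b a < above_excess b b"
      using b 3 less.prems(2) bounds connected_in_refl[OF b] by (auto simp: invariants_def above_excess_def)
    obtain e L where e: "K = add_mset e L" "above_excess b e > 0" using partner[OF f] by blast
    then have eb: "conn e b" "head_sum e < head_sum r" by (auto simp: above_excess_def split: if_splits)
    have ea: "conn e a" using eb less.prems(2) connected_in_trans connected_in_sym by blast
    have "s \<noteq> 0" using 3 by (cases s) auto
    then have s2: "2 \<le> s" using s_neq by simp
    have "s < head_sum a" using 3 bounds by simp
    then obtain e' a' where a': "{#e, a#} \<leadsto> {#e', a'#}" "conn a a'"
        "\<And>i. i \<in> {s+1..n} \<Longrightarrow> a' i = a i" "head_sum a' + 1 = head_sum a"
      using transfer_unit[OF ea s2 eb(2)] by metis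
    have "M \<leadsto> add_mset a' (add_mset e' L)"
      using less.prems(1) switches_to_plus[OF a'(1), of L] e(1) by (simp add: add_mset_commute)
    moreover have "conn a' b" using a'(2) less.prems(2) connected_in_trans connected_in_sym by blast
    moreover have "(head_sum a' - head_sum b) + (head_sum b - head_sum a') <
        (head_sum a - head_sum b) + (head_sum b - head_sum a)" using a'(4) 3 by simp
    ultimately show ?thesis using less.hyps a'(3) less.prems(3) by metis
  qed
qed

text \<open>
  Once an entry equivalent to \<open>b\<close> has been produced, both multisets share it, and the remaining
  entries again have equal invariants. If the target is empty, then so is \<open>M\<close>, because each entry is
  counted by the invariant that compares it with itself.
\<close>

lemma invariants_complete:
  assumes "set_mset M \<subseteq> S" "set_mset N \<subseteq> S"
    and "\<And>f. f \<in> invariants \<Longrightarrow> (\<Sum>a \<in># M. f a) = (\<Sum>a \<in># N. f a)"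
  shows "M \<leadsto> N"
  using assms
proof (induction N arbitrary: M)
  case empty
  have "M = {#}"
  proof (rule ccontr)
    assume "M \<noteq> {#}"
    then obtain a K where a: "M = add_mset a K" by (meson multiset_cases)
    then have "a \<in> S" using empty.prems(1) by simp
    then have "agrees_on {max s t + 1..n} a \<in> invariants" "agrees_on {max s t + 1..n} a a = 1"
      using connected_in_refl by (auto simp: invariants_def agrees_on_def)
    then show False using empty.prems(3) a by fastforce
  qed
  then show ?case by simp
next
  case (add b N)
  have b: "b \<in> S" using add.prems(2) by simp
  obtain a K where aK: "M \<leadsto> add_mset a K" "conn a b" "\<forall>i \<in> {s+1..t} \<union> {max s t + 1..n}. a i = b i"
    using match_entries[OF add.prems(1) b add.prems(3) order_refl] by blast
  have "a i = b i" if "i \<in> {s+1..n}" for i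
    using aK(3) that by (cases "i \<le> t") auto
  then obtain a K where a: "M \<leadsto> add_mset a K" "a \<in> S" "(a, b) \<in> s_equiv n r s"
    using match_head_sum[OF b add.prems(3) aK(1,2)] by blast
  then have MbK: "M \<leadsto> add_mset b K"
    using switch_step.replace rtranclp.rtrancl_into_rtrancl by metis
  have "K \<leadsto> N"
  proof (rule add.IH)
    show "set_mset K \<subseteq> S" using switches_to_subset[OF MbK add.prems(1)] by simp
    show "set_mset N \<subseteq> S" using add.prems(2) by simp
    show "(\<Sum>a \<in># K. f a) = (\<Sum>a \<in># N. f a)" if f: "f \<in> invariants" for f
      using switch_invariant_sum[OF invariants_invariant[OF f] MbK] add.prems(3)[OF f] by simp
  qed
  then have "add_mset b K \<leadsto> add_mset b N"
    using switches_to_plus[of K N "{#b#}"] by simp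
  then show ?case using MbK by simp
qed

end

section \<open>The ideals of switchable sets are toric\<close>

lemma fbin_var_prod:
  "fbin n r s i a b = var_prod {#s_equiv n r s `` {a}, s_equiv n r s `` {b}#} -
     var_prod {#s_equiv n r s `` {sw i a b}, s_equiv n r s `` {sw i b a}#}"
  by (simp add: fbin_def xvar_def var_prod_def)

lemma R_ring_ring: "ring (R_ring n r s)"
  unfolding R_ring_def by (rule poly_ring_over_ring)

lemma R_ring_closed:
  assumes "p \<in> carrier (R_ring n r s)" "q \<in> carrier (R_ring n r s)"
  shows "p * q \<in> carrier (R_ring n r s)" "p - q \<in> carrier (R_ring n r s)"
proof -
  interpret R: ring "R_ring n r s" by (rule R_ring_ring)
  show "p * q \<in> carrier (R_ring n r s)"
    using R.m_closed[OF assms] by (simp add: R_ring_def poly_ring_over_simps(2))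
  have "ideal (carrier (R_ring n r s)) (R_ring n r s)" by (rule R.oneideal)
  then show "p - q \<in> carrier (R_ring n r s)"
    using assms unfolding R_ring_def by (rule poly_ideal_diff)
qed

lemma fbin_closed:
  assumes "a \<in> indices n r" "b \<in> indices n r" "i \<in> {1..n}"
  shows "fbin n r s i a b \<in> carrier (R_ring n r s)"
  unfolding fbin_def using assms by (intro R_ring_closed xvar_closed sw_in_indices)

text \<open>
  From here on the sum of two generated ideals is only used through its generators.
\<close>

lemma P_ideal_generators:
  assumes "S \<subseteq> indices n r" "t \<le> n"
  shows P_ideal_ideal: "ideal (P_ideal n r s t S :: 'k::field spoly set) (R_ring n r s)"
    and xvar_in_P_ideal: "a \<in> indices n r - S \<Longrightarrow> (xvar n r s a :: 'k spoly) \<in> P_ideal n r s t S"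
    and fbin_in_P_ideal: "i \<in> {1..t} \<Longrightarrow> connected_in n S a b \<Longrightarrow>
      (fbin n r s i a b :: 'k spoly) \<in> P_ideal n r s t S"
    and P_ideal_least: "ideal J (R_ring n r s) \<Longrightarrow>
      (\<And>a. a \<in> indices n r - S \<Longrightarrow> (xvar n r s a :: 'k spoly) \<in> J) \<Longrightarrow>
      (\<And>i a b. i \<in> {1..t} \<Longrightarrow> connected_in n S a b \<Longrightarrow> fbin n r s i a b \<in> J) \<Longrightarrow>
      P_ideal n r s t S \<subseteq> J"
proof -
  interpret R: ring "R_ring n r s :: 'k spoly ring" by (rule R_ring_ring)
  let ?X = "{xvar n r s a | a. a \<in> indices n r - S} :: 'k spoly set"
  let ?F = "{fbin n r s i a b | i a b. i \<in> {1..t} \<and> a \<in> S \<and> b \<in> S \<and> connected_in n S a b} :: 'k spoly set"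
  have X: "?X \<subseteq> carrier (R_ring n r s)" using xvar_closed by auto
  have F: "?F \<subseteq> carrier (R_ring n r s)"
  proof
    fix p assume "p \<in> ?F"
    then obtain i a b where "p = fbin n r s i a b" "i \<in> {1..t}" "a \<in> S" "b \<in> S" by blast
    then show "p \<in> carrier (R_ring n r s)" using assms by (auto intro!: fbin_closed)
  qed
  have var: "ideal (Var_ideal n r s S :: 'k spoly set) (R_ring n r s)"
    unfolding Var_ideal_def by (rule R.genideal_ideal[OF X])
  have tilde: "ideal (I_tilde n r s t S :: 'k spoly set) (R_ring n r s)"
    unfolding I_tilde_def by (rule R.genideal_ideal[OF F])
  show "ideal (P_ideal n r s t S :: 'k spoly set) (R_ring n r s)"
    unfolding P_ideal_def by (rule R.add_ideals[OF var tilde])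
  have sum: "p \<in> P_ideal n r s t S \<longleftrightarrow> (\<exists>v \<in> Var_ideal n r s S. \<exists>w \<in> I_tilde n r s t S. p = v + w)"
    for p :: "'k spoly"
    by (simp add: P_ideal_def set_add_defs R_ring_def poly_ring_over_simps(3))
  have zero: "0 \<in> (Var_ideal n r s S :: 'k spoly set)" "0 \<in> (I_tilde n r s t S :: 'k spoly set)"
    using poly_ideal_zero var tilde unfolding R_ring_def by blast+
  show "(xvar n r s a :: 'k spoly) \<in> P_ideal n r s t S" if "a \<in> indices n r - S"
  proof -
    have "(xvar n r s a :: 'k spoly) \<in> Var_ideal n r s S"
      unfolding Var_ideal_def using R.genideal_self[OF X] that by blast
    then show ?thesis unfolding sum using zero by (metis add.right_neutral)
  qed
  show "(fbin n r s i a b :: 'k spoly) \<in> P_ideal n r s t S"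
    if "i \<in> {1..t}" "connected_in n S a b"
  proof -
    have "(fbin n r s i a b :: 'k spoly) \<in> I_tilde n r s t S"
      unfolding I_tilde_def using R.genideal_self[OF F] that connected_in_mem[OF that(2)] by blast
    then show ?thesis unfolding sum using zero by (metis add.left_neutral)
  qed
  show "P_ideal n r s t S \<subseteq> J" if J: "ideal J (R_ring n r s)"
    and vars: "\<And>a. a \<in> indices n r - S \<Longrightarrow> (xvar n r s a :: 'k spoly) \<in> J"
    and bins: "\<And>i a b. i \<in> {1..t} \<Longrightarrow> connected_in n S a b \<Longrightarrow> fbin n r s i a b \<in> J"
  proof
    fix p :: "'k spoly" assume "p \<in> P_ideal n r s t S"
    then obtain v w where p: "v \<in> Var_ideal n r s S" "w \<in> I_tilde n r s t S" "p = v + w"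
      unfolding sum by blast
    have "Var_ideal n r s S \<subseteq> J"
      unfolding Var_ideal_def by (rule R.genideal_minimal[OF J]) (use vars in blast)
    moreover have "I_tilde n r s t S \<subseteq> J"
      unfolding I_tilde_def by (rule R.genideal_minimal[OF J]) (use bins in blast)
    ultimately have "v \<in> J" "w \<in> J" using p by blast+
    then show "p \<in> J" using J unfolding p(3) R_ring_def by (blast intro: poly_ideal_add)
  qed
qed

context switchable_set begin

abbreviation var_class :: "index \<Rightarrow> index set" where "var_class a \<equiv> s_equiv n r s `` {a}"

text \<open>
  The variables are classes of indices, whereas the invariants are functions of indices; by
  \<open>switch_invariant\<close> any representative may be used for a class that meets \<open>S\<close>.
\<close>

definition on_classes :: "(index \<Rightarrow> nat) \<Rightarrow> index set \<Rightarrow> nat" where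
  "on_classes f v = f (SOME a. a \<in> v)"

lemma on_classes_eq:
  assumes "f \<in> invariants" "a \<in> S"
  shows "on_classes f (var_class a) = f a"
proof -
  have "a \<in> var_class a" using S_indices[OF assms(2)] by (simp add: s_equiv_def)
  then have "(SOME b. b \<in> var_class a) \<in> var_class a" by (rule someI[of "\<lambda>b. b \<in> var_class a"])
  then show ?thesis
    using invariants_invariant[OF assms(1)] assms(2) unfolding switch_invariant_def on_classes_def by auto
qed

lemma var_class_in_image: "a \<in> indices n r \<Longrightarrow> var_class a \<in> var_class ` S \<longleftrightarrow> a \<in> S"
  using S_equiv S_indices eq_equiv_class_iff[OF equiv_s_equiv] by blast

lemma on_classes_sum:
  assumes "f \<in> invariants" "set_mset M \<subseteq> S"
  shows "(\<Sum>v \<in># image_mset var_class M. on_classes f v) = (\<Sum>a \<in># M. f a)"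
  using assms(2) by (induction M) (simp_all add: on_classes_eq[OF assms(1)])

lemma S_subset: "S \<subseteq> indices n r"
  using S_indices by blast

lemma t_le: "t \<le> n"
  using t by simp

lemmas P_ideal_facts = P_ideal_generators[OF S_subset t_le]

text \<open>
  Each switch changes the product of variables by a monomial multiple of a generator.
\<close>

lemma P_ideal_switches:
  assumes "M \<leadsto> N" "set_mset M \<subseteq> S"
  shows "(var_prod (image_mset var_class M) - var_prod (image_mset var_class N) :: 'k::field spoly)
    \<in> P_ideal n r s t S"
  using assms(1)
proof (induction rule: rtranclp_induct)
  case base
  show ?case using poly_ideal_zero P_ideal_facts(1) unfolding R_ring_def by force
next
  case (step M' N)
  let ?X = "\<lambda>M. var_prod (image_mset var_class M) :: 'k spoly"
  have J: "ideal (P_ideal n r s t S :: 'k spoly set) (poly_ring_over (indices n r // s_equiv n r s))"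
    using P_ideal_facts(1) unfolding R_ring_def .
  have M'S: "set_mset M' \<subseteq> S" using switches_to_subset[OF step.hyps(1) assms(2)] .
  from step.hyps(2) have "?X M' - ?X N \<in> P_ideal n r s t S"
  proof cases
    case (switch a b i K)
    have "set_mset (image_mset var_class K) \<subseteq> indices n r // s_equiv n r s"
      using M'S S_indices switch(1) by (auto intro: quotientI)
    then have "?X K \<in> carrier (poly_ring_over (indices n r // s_equiv n r s))"
      unfolding var_prod_single by (intro single_in_poly_ring) (simp add: vars_of_mset)
    then have "?X K * fbin n r s i a b \<in> P_ideal n r s t S"
      using poly_ideal_mult[OF J] P_ideal_facts(3)[of i a b] switch(3,4) by blast
    then show ?thesis
      unfolding switch(1,2) fbin_var_prod by (simp add: var_prod_def algebra_simps)
  next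
    case (replace a b K)
    then have "var_class a = var_class b" using equiv_class_eq[OF equiv_s_equiv] by blast
    then show ?thesis unfolding replace(1,2) using poly_ideal_zero[OF J] by simp
  qed
  from poly_ideal_add[OF J step.IH this] show ?case by simp
qed

text \<open>
  The crucial description: the ideal of a switchable set is the kernel of the monomial map given by
  the invariants. One inclusion says that the invariants are invariant, the other one that they are
  complete.
\<close>

lemma P_ideal_toric:
  obtains fs where "(P_ideal n r s t S :: 'k::field spoly set) =
    toric_ideal (indices n r // s_equiv n r s) (var_class ` S) fs"
proof -
  obtain fs where fs: "set fs = on_classes ` invariants"
    using finite_list finite_invariants by (metis finite_imageI)
  let ?V = "indices n r // s_equiv n r s"
  let ?K = "toric_ideal ?V (var_class ` S) fs :: 'k spoly set"
  have K: "ideal ?K (R_ring n r s)"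
    unfolding R_ring_def using toric_ideal_prime by (rule primeideal.axioms(1))
  have "P_ideal n r s t S \<subseteq> ?K"
  proof (rule P_ideal_facts(4)[OF K])
    fix a assume a: "a \<in> indices n r - S"
    then have "(xvar n r s a :: 'k spoly) \<in> carrier (poly_ring_over ?V)"
      using xvar_closed[of a n r s] unfolding R_ring_def by blast
    then show "xvar n r s a \<in> ?K"
      using a var_class_in_image[of a] by (simp add: toric_ideal_def xvar_def toric_map_pvar_eq_0_iff)
  next
    fix i a b assume i: "i \<in> {1..t}" and ab: "conn a b"
    have mem: "a \<in> S" "b \<in> S" "sw i a b \<in> S" "sw i b a \<in> S"
      using ab conn_sw[OF ab i] connected_in_mem by blast+
    have "toric_map (var_class ` S) fs (fbin n r s i a b :: 'k spoly) = 0"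
      unfolding fbin_var_prod
    proof (subst toric_binomial_iff)
      show "\<forall>f \<in> set fs. (\<Sum>v \<in># {#var_class a, var_class b#}. f v) =
          (\<Sum>v \<in># {#var_class (sw i a b), var_class (sw i b a)#}. f v)"
      proof
        fix g assume "g \<in> set fs"
        then obtain f where f: "f \<in> invariants" "g = on_classes f" using fs by blast
        have "f a + f b = f (sw i a b) + f (sw i b a)"
          using invariants_invariant[OF f(1)] ab i unfolding switch_invariant_def by blast
        then show "(\<Sum>v \<in># {#var_class a, var_class b#}. g v) =
            (\<Sum>v \<in># {#var_class (sw i a b), var_class (sw i b a)#}. g v)"
          using mem by (simp add: f(2) on_classes_eq[OF f(1)])
      qed
    qed (use mem in auto)
    moreover have "(fbin n r s i a b :: 'k spoly) \<in> carrier (poly_ring_over ?V)"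
      using fbin_closed[of a n r b i s] mem S_indices i t unfolding R_ring_def by auto
    ultimately show "fbin n r s i a b \<in> ?K" by (simp add: toric_ideal_def)
  qed
  moreover have "?K \<subseteq> P_ideal n r s t S"
  proof (rule toric_ideal_subset)
    show "ideal (P_ideal n r s t S :: 'k spoly set) (poly_ring_over ?V)"
      using P_ideal_facts(1) unfolding R_ring_def .
  next
    fix v assume v: "v \<in> ?V - var_class ` S"
    then obtain a where a: "a \<in> indices n r" "v = var_class a" by (auto elim: quotientE)
    then have "a \<notin> S" using v by blast
    then show "(pvar v :: 'k spoly) \<in> P_ideal n r s t S"
      using P_ideal_facts(2)[of a] a by (simp add: xvar_def)
  next
    fix M N assume M: "set_mset M \<subseteq> var_class ` S" and N: "set_mset N \<subseteq> var_class ` S"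
      and eq: "\<And>f. f \<in> set fs \<Longrightarrow> (\<Sum>v \<in># M. f v) = (\<Sum>v \<in># N. f v)"
    have lift: "\<exists>L'. L = image_mset var_class L' \<and> set_mset L' \<subseteq> S" if "set_mset L \<subseteq> var_class ` S" for L
      using that
    proof (induction L)
      case (add v L)
      then obtain a L' where "v = var_class a" "a \<in> S" "L = image_mset var_class L'" "set_mset L' \<subseteq> S"
        by auto
      then show ?case by (intro exI[of _ "add_mset a L'"]) simp
    qed simp
    obtain M' where M': "M = image_mset var_class M'" "set_mset M' \<subseteq> S" using lift[OF M] by blast
    obtain N' where N': "N = image_mset var_class N'" "set_mset N' \<subseteq> S" using lift[OF N] by blast
    have "M' \<leadsto> N'"
    proof (rule invariants_complete[OF M'(2) N'(2)])
      fix f assume f: "f \<in> invariants"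
      then show "(\<Sum>a \<in># M'. f a) = (\<Sum>a \<in># N'. f a)"
        using eq[of "on_classes f"] fs on_classes_sum[OF f M'(2)] on_classes_sum[OF f N'(2)]
        unfolding M'(1) N'(1) by simp
    qed
    then show "(var_prod M - var_prod N :: 'k spoly) \<in> P_ideal n r s t S"
      unfolding M'(1) N'(1) using M'(2) by (rule P_ideal_switches)
  qed
  ultimately show ?thesis using that by blast
qed

lemma P_ideal_prime: "primeideal (P_ideal n r s t S :: 'k::field spoly set) (R_ring n r s)"
  using P_ideal_toric toric_ideal_prime unfolding R_ring_def by metis

lemma xvar_in_P_ideal_iff:
  assumes "a \<in> indices n r"
  shows "(xvar n r s a :: 'k::field spoly) \<in> P_ideal n r s t S \<longleftrightarrow> a \<notin> S"
proof
  assume "(xvar n r s a :: 'k spoly) \<in> P_ideal n r s t S"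
  moreover obtain fs where "(P_ideal n r s t S :: 'k spoly set) =
      toric_ideal (indices n r // s_equiv n r s) (var_class ` S) fs"
    by (rule P_ideal_toric)
  ultimately have "toric_map (var_class ` S) fs (pvar (var_class a) :: 'k spoly) = 0"
    by (simp add: toric_ideal_def xvar_def)
  then show "a \<notin> S" by (auto simp: toric_map_pvar_eq_0_iff)
next
  assume "a \<notin> S"
  then show "(xvar n r s a :: 'k spoly) \<in> P_ideal n r s t S"
    using assms by (intro P_ideal_facts(2)) simp
qed

section \<open>Primes over the switching ideal\<close>

text \<open>
  A pair at distance two inside \<open>S\<close> is connected, or its binomial is zero. For any other pair, both
  terms of the binomial have a factor outside \<open>S\<close>: switching the switched indices again gives back
  \<open>a\<close> and \<open>b\<close>, so they cannot both lie in \<open>S\<close> either.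
\<close>

lemma I_ideal_subset_P_ideal: "I_ideal n r s t \<subseteq> (P_ideal n r s t S :: 'k::field spoly set)"
proof -
  interpret R: ring "R_ring n r s :: 'k spoly ring" by (rule R_ring_ring)
  have J: "ideal (P_ideal n r s t S :: 'k spoly set) (poly_ring_over (indices n r // s_equiv n r s))"
    using P_ideal_facts(1) unfolding R_ring_def .
  show ?thesis
    unfolding I_ideal_def
  proof (rule R.genideal_minimal[OF P_ideal_facts(1)], rule subsetI)
    fix p :: "'k spoly"
    assume "p \<in> {fbin n r s i a b |i a b. i \<in> {1..t} \<and> a \<in> indices n r \<and> b \<in> indices n r \<and> idist n a b = 2}"
    then obtain i a b where p: "p = fbin n r s i a b" and i: "i \<in> {1..t}"
        and ab: "a \<in> indices n r" "b \<in> indices n r" and d: "idist n a b = 2"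
      by blast
    let ?a = "sw i a b" and ?b = "sw i b a"
    have sw: "?a \<in> indices n r" "?b \<in> indices n r" using ab i t by (auto intro!: sw_in_indices)
    have sw_back: "sw i ?a ?b = a" "sw i ?b ?a = b" by (simp_all add: sw_def)
    have "{k \<in> {1..n}. ?a k \<noteq> ?b k} = {k \<in> {1..n}. a k \<noteq> b k}" by (auto simp: sw_def)
    then have d': "idist n ?a ?b = 2" using d by (simp add: idist_def)
    have closed: "?a \<in> S \<and> ?b \<in> S" if "a \<in> S" "b \<in> S"
    proof -
      have "{k \<in> {1..n}. b k \<noteq> a k} = {k \<in> {1..n}. a k \<noteq> b k}" by auto
      then have "idist n b a = 2" using d by (simp add: idist_def)
      then show ?thesis using S that d i unfolding switchable_def by blast
    qed
    have closed': "a \<in> S \<and> b \<in> S" if "?a \<in> S" "?b \<in> S"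
    proof -
      have "{k \<in> {1..n}. ?b k \<noteq> ?a k} = {k \<in> {1..n}. ?a k \<noteq> ?b k}" by auto
      then have "idist n ?b ?a = 2" using d' by (simp add: idist_def)
      then have "sw i ?a ?b \<in> S" "sw i ?b ?a \<in> S"
        using S that d' i unfolding switchable_def by blast+
      then show ?thesis by (simp add: sw_back)
    qed
    show "p \<in> P_ideal n r s t S"
    proof (cases "a \<in> S \<and> b \<in> S")
      case True
      obtain k j where kj: "{k \<in> {1..n}. a k \<noteq> b k} = {k, j}"
        using d unfolding idist_def by (auto simp: card_2_iff)
      show ?thesis
      proof (cases "a i = b i")
        case True
        then have "?a = a" "?b = b" by (auto simp: sw_def fun_eq_iff)
        then show ?thesis using poly_ideal_zero[OF J] by (simp add: p fbin_def)
      next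
        case False
        have "i \<in> {k \<in> {1..n}. a k \<noteq> b k}" using False i t by auto
        then have "i = k \<or> i = j" unfolding kj by blast
        then obtain l where l: "{k, j} = {i, l}" by blast
        have "a m = b m" if "m \<noteq> i" "m \<noteq> l" for m
        proof (cases "m \<in> {1..n}")
          case True
          then show ?thesis using kj that unfolding l by blast
        next
          case False
          then show ?thesis using S_outside \<open>a \<in> S \<and> b \<in> S\<close> by blast
        qed
        then have "conn a b" using conn_two_positions[of a b i l] \<open>a \<in> S \<and> b \<in> S\<close> i by blast
        then show ?thesis unfolding p using i by (intro P_ideal_facts(3))
      qed
    next
      case False
      have prod: "xvar n r s c * xvar n r s d \<in> (P_ideal n r s t S :: 'k spoly set)"
        if "c \<in> indices n r" "d \<in> indices n r" "\<not> (c \<in> S \<and> d \<in> S)" for c d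
      proof -
        have cd: "(xvar n r s c :: 'k spoly) \<in> carrier (poly_ring_over (indices n r // s_equiv n r s))"
          "(xvar n r s d :: 'k spoly) \<in> carrier (poly_ring_over (indices n r // s_equiv n r s))"
          using xvar_closed that(1,2) unfolding R_ring_def by blast+
        show ?thesis
        proof (cases "c \<in> S")
          case True
          then have "(xvar n r s d :: 'k spoly) \<in> P_ideal n r s t S"
            using that by (intro P_ideal_facts(2)) simp
          then show ?thesis using poly_ideal_mult[OF J _ cd(1)] by blast
        next
          case False
          then have "(xvar n r s c :: 'k spoly) \<in> P_ideal n r s t S"
            using that by (intro P_ideal_facts(2)) simp
          then show ?thesis using poly_ideal_mult[OF J _ cd(2)] by (metis mult.commute)
        qed
      qed
      show ?thesis
        unfolding p fbin_def using False closed' ab sw by (intro poly_ideal_diff[OF J] prod) blast+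
    qed
  qed
qed

lemma fbin_adjacent_in_I_ideal:
  assumes "a \<in> S" "b \<in> S" "i \<in> {1..t}" and diff: "\<And>k. k \<noteq> i \<Longrightarrow> k \<noteq> j \<Longrightarrow> a k = b k"
  shows "(fbin n r s i a b :: 'k::field spoly) \<in> I_ideal n r s t"
proof -
  interpret R: ring "R_ring n r s :: 'k spoly ring" by (rule R_ring_ring)
  let ?F = "{fbin n r s i a b |i a b. i \<in> {1..t} \<and> a \<in> indices n r \<and> b \<in> indices n r \<and> idist n a b = 2}
    :: 'k spoly set"
  have F: "?F \<subseteq> carrier (R_ring n r s)"
  proof
    fix p assume "p \<in> ?F"
    then obtain i a b where "p = fbin n r s i a b" "i \<in> {1..t}" "a \<in> indices n r" "b \<in> indices n r"
      by blast
    then show "p \<in> carrier (R_ring n r s)" using t by (auto intro!: fbin_closed)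
  qed
  have J: "ideal (I_ideal n r s t :: 'k spoly set) (poly_ring_over (indices n r // s_equiv n r s))"
    using R.genideal_ideal[OF F] unfolding I_ideal_def R_ring_def .
  consider "a i = b i" | "a j = b j \<or> i = j" | "a i \<noteq> b i" "a j \<noteq> b j" "i \<noteq> j" by blast
  then show ?thesis
  proof cases
    case 1
    then have "sw i a b = a" "sw i b a = b" by (auto simp: sw_def fun_eq_iff)
    then show ?thesis using poly_ideal_zero[OF J] by (simp add: fbin_def)
  next
    case 2
    then have "sw i a b = b" "sw i b a = a" using diff by (fastforce simp: sw_def fun_eq_iff)+
    then show ?thesis using poly_ideal_zero[OF J] by (simp add: fbin_def mult.commute)
  next
    case 3
    then have "{k \<in> {1..n}. a k \<noteq> b k} = {i, j}"
      using diff S_outside[OF assms(1,2)] by blast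
    then have "idist n a b = 2" using 3 by (simp add: idist_def)
    then have "fbin n r s i a b \<in> ?F" using assms(1-3) S_indices by blast
    then show ?thesis unfolding I_ideal_def using R.genideal_self[OF F] by blast
  qed
qed

text \<open>
  A prime that contains no variable of \<open>S\<close> allows cancelling them, and this extends the binomials
  from pairs at distance two to all connected pairs, by induction along a path from \<open>a\<close> to \<open>b\<close>. The
  induction hypothesis is asserted for every \<open>a'\<close> that differs from \<open>a\<close> only at \<open>i\<close>, so that a step
  that changes position \<open>i\<close> needs no work. For a step at another position \<open>j\<close>, let \<open>c'\<close> be the index
  obtained from \<open>a'\<close> by the same step. Then \<open>x\<^bsub>c'\<^esub> f\<^bsub>i,a',b\<^esub>\<close> is a combination of
  \<open>f\<^bsub>i,c',b\<^esub>\<close> and a binomial of a pair that differs only at \<open>i\<close> and \<open>j\<close>, and \<open>x\<^bsub>c'\<^esub>\<close> can be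
  cancelled.
\<close>

lemma fbin_in_prime:
  fixes Q :: "'k::field spoly set"
  assumes Q: "primeideal Q (R_ring n r s)" and I: "I_ideal n r s t \<subseteq> Q"
    and vars: "\<And>a. a \<in> S \<Longrightarrow> xvar n r s a \<notin> Q"
    and ab: "conn a b" and i: "i \<in> {1..t}"
  shows "fbin n r s i a b \<in> Q"
proof -
  have J: "ideal Q (poly_ring_over (indices n r // s_equiv n r s))"
    using Q primeideal.axioms(1) unfolding R_ring_def by blast
  have b: "b \<in> S" and a: "a \<in> S" using ab connected_in_mem by blast+
  have i_n: "i \<in> {1..n}" using i t by auto
  have "(a, b) \<in> {(c, d). c \<in> S \<and> d \<in> S \<and> idist n c d = 1}\<^sup>*"
    using ab by (simp add: connected_in_iff_rtrancl)
  then have "\<forall>a' \<in> S. (\<forall>k. k \<noteq> i \<longrightarrow> a' k = a k) \<longrightarrow> fbin n r s i a' b \<in> Q"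
  proof (induction rule: converse_rtrancl_induct)
    case base
    show ?case
    proof (intro ballI impI)
      fix a' assume "a' \<in> S" "\<forall>k. k \<noteq> i \<longrightarrow> a' k = b k"
      then show "fbin n r s i a' b \<in> Q"
        using fbin_adjacent_in_I_ideal[of a' b i i] b i I by blast
    qed
  next
    case (step a c)
    then have ac: "a \<in> S" "c \<in> S" "idist n a c = 1" by auto
    obtain j where "c = a(j := c j)"
      using idist_le_1_cases[OF S_indices[OF ac(1)] S_indices[OF ac(2)] ac(3)] .
    then have j: "c k = a k" if "k \<noteq> j" for k using that by (metis fun_upd_other)
    have cb: "conn c b" using step.hyps(2) ac(2) by (simp add: connected_in_iff_rtrancl)
    show ?case
    proof (intro ballI impI)
      fix a' assume a': "a' \<in> S" and diff: "\<forall>k. k \<noteq> i \<longrightarrow> a' k = a k"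
      show "fbin n r s i a' b \<in> Q"
      proof (cases "j = i")
        case True
        then have "\<forall>k. k \<noteq> i \<longrightarrow> a' k = c k" using diff j by simp
        then show ?thesis using step.IH a' by blast
      next
        case False
        \<comment> \<open>\<open>?c\<close> is \<open>a'\<close> after the step at position \<open>j\<close>; it lies in \<open>S\<close> as a switch of \<open>c\<close> with \<open>a'\<close>\<close>
        let ?c = "c(i := a' i)"
        have c: "?c \<in> S"
          by (rule switch_adjacent[OF ac(2) a' i, of j]) (simp add: diff j)
        have IH: "fbin n r s i ?c b \<in> Q" using step.IH c by simp
        have "conn ?c b"
          using conn_upd[OF ac(2) c] cb connected_in_trans connected_in_sym by blast
        then have "?c(i := b i) \<in> S" using conn_switch[OF _ i] connected_in_mem by blast
        moreover define e where "e = sw i ?c b"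
        ultimately have e: "e \<in> S" by (simp add: sw_def)
        define g where "g = sw i a' b"
        define h where "h = sw i b a'"
        have "fbin n r s i a' e \<in> I_ideal n r s t"
          by (rule fbin_adjacent_in_I_ideal[OF a' e i, of j]) (simp add: e_def sw_def diff j)
        then have ae: "fbin n r s i a' e \<in> Q" using I by blast
        have "sw i a' e = g" "sw i e a' = ?c" "sw i b ?c = h"
          using False diff j by (auto simp: e_def g_def h_def sw_def fun_eq_iff)
        then have gens: "xvar n r s a' * xvar n r s e - xvar n r s g * xvar n r s ?c \<in> Q"
            "xvar n r s ?c * xvar n r s b - xvar n r s e * xvar n r s h \<in> Q"
          using ae IH unfolding fbin_def by (simp_all flip: e_def)
        have gh: "g \<in> indices n r" "h \<in> indices n r"
          unfolding g_def h_def using a' b S_indices i_n by (auto intro!: sw_in_indices)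
        have carr: "(xvar n r s a' :: 'k spoly) \<in> carrier (poly_ring_over (indices n r // s_equiv n r s))"
          "(xvar n r s h :: 'k spoly) \<in> carrier (poly_ring_over (indices n r // s_equiv n r s))"
          using xvar_closed a' gh S_indices unfolding R_ring_def by blast+
        have "xvar n r s ?c * fbin n r s i a' b =
            xvar n r s a' * (xvar n r s ?c * xvar n r s b - xvar n r s e * xvar n r s h) +
            xvar n r s h * (xvar n r s a' * xvar n r s e - xvar n r s g * xvar n r s ?c :: 'k spoly)"
          unfolding fbin_def by (simp add: algebra_simps flip: g_def h_def)
        also have "\<dots> \<in> Q"
          by (intro poly_ideal_add[OF J] poly_ideal_mult[OF J] gens carr)
        finally have "xvar n r s ?c \<otimes>\<^bsub>R_ring n r s\<^esub> fbin n r s i a' b \<in> Q"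
          by (simp add: R_ring_def poly_ring_over_simps(2))
        then have "xvar n r s ?c \<in> Q \<or> fbin n r s i a' b \<in> Q"
          by (rule primeideal.I_prime[OF Q xvar_closed[OF S_indices[OF c]]
                fbin_closed[OF S_indices[OF a'] S_indices[OF b] i_n]])
        then show ?thesis using vars[OF c] by blast
      qed
    qed
  qed
  then show ?thesis using a by blast
qed

end

text \<open>
  The indices whose variable is not in the prime form a switchable set: for \<open>a\<close> and \<open>b\<close> among
  them at distance two, the product \<open>x\<^sub>a x\<^sub>b\<close> lies outside the prime, hence so does the product of
  the switched variables, to which it is congruent.
\<close>

lemma prime_contains_P_ideal:
  fixes Q :: "'k::field spoly set"
  assumes t: "t \<in> {1..n}" and s: "s \<le> n" "s \<noteq> 1" and r: "\<And>i. i \<in> {1..n} \<Longrightarrow> r i \<ge> 2"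
    and Q: "primeideal Q (R_ring n r s)" and I: "I_ideal n r s t \<subseteq> Q"
  obtains S where "switchable n r s t S" "P_ideal n r s t S \<subseteq> Q"
proof -
  let ?S = "{a \<in> indices n r. xvar n r s a \<notin> Q}"
  have idealQ: "ideal Q (R_ring n r s)" using Q primeideal.axioms(1) by blast
  then have J: "ideal Q (poly_ring_over (indices n r // s_equiv n r s))" unfolding R_ring_def .
  interpret R: ring "R_ring n r s :: 'k spoly ring" by (rule R_ring_ring)
  have S: "switchable n r s t ?S"
    unfolding switchable_def
  proof (intro conjI ballI allI impI)
    fix a b i assume a: "a \<in> ?S" and b: "b \<in> ?S" and d: "idist n a b = 2" and i: "i \<in> {1..t}"
    have i_n: "i \<in> {1..n}" using i t by auto
    have ab: "a \<in> indices n r" "b \<in> indices n r" using a b by simp_all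
    have sw: "sw i a b \<in> indices n r" "sw i b a \<in> indices n r"
      using ab i_n by (auto intro!: sw_in_indices)
    have "xvar n r s (sw i a b) \<notin> Q"
    proof
      assume in_Q: "xvar n r s (sw i a b) \<in> Q"
      have "fbin n r s i a b \<in> (I_ideal n r s t :: 'k spoly set)"
        unfolding I_ideal_def genideal_def using a b i d by blast
      then have "fbin n r s i a b \<in> Q" using I by blast
      moreover have "xvar n r s (sw i b a) * xvar n r s (sw i a b) \<in> Q"
        using poly_ideal_mult[OF J in_Q] xvar_closed[OF sw(2)] unfolding R_ring_def by blast
      ultimately have "fbin n r s i a b + xvar n r s (sw i b a) * xvar n r s (sw i a b) \<in> Q"
        by (rule poly_ideal_add[OF J])
      then have "xvar n r s a \<otimes>\<^bsub>R_ring n r s\<^esub> xvar n r s b \<in> Q"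
        by (simp add: fbin_def R_ring_def poly_ring_over_simps(2) mult.commute)
      then have "xvar n r s a \<in> Q \<or> xvar n r s b \<in> Q"
        by (rule primeideal.I_prime[OF Q xvar_closed[OF ab(1)] xvar_closed[OF ab(2)]])
      then show False using a b by simp
    qed
    then show "sw i a b \<in> ?S" using sw by simp
  next
    fix a b assume a: "a \<in> ?S" and ab: "(a, b) \<in> s_equiv n r s"
    then have b: "b \<in> indices n r" by (simp add: s_equiv_def)
    then have "(xvar n r s a :: 'k spoly) = xvar n r s b"
      using xvar_eq_iff[of a n r b s] a ab by blast
    then show "b \<in> ?S" using a b by simp
  qed auto
  interpret switchable_set n s t r ?S
    using t s r S by unfold_locales
  have "P_ideal n r s t ?S \<subseteq> Q"
    by (rule P_ideal_facts(4)[OF idealQ]) (auto intro: fbin_in_prime[OF Q I])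
  then show ?thesis using that S by blast
qed

text \<open>
  The primes \<open>P\<^sub>S\<close> lie over the ideal, and every prime over it contains one of them; so the minimal
  primes are the minimal ones among the \<open>P\<^sub>S\<close>. Since \<open>S\<close> is recovered from \<open>P\<^sub>S\<close> as the set of
  indices whose variable is not in it, \<open>P\<^sub>T \<subseteq> P\<^sub>S\<close> forces \<open>S \<subseteq> T\<close>, and minimality becomes
  maximality of \<open>S\<close>.
\<close>

lemma minimal_primes_eq_maximal_switchable:
  assumes t: "t \<in> {1..n}" and s: "s \<le> n" "s \<noteq> 1" and r: "\<And>i. i \<in> {1..n} \<Longrightarrow> r i \<ge> 2"
  shows "minimal_primes_over (R_ring n r s) (I_ideal n r s t :: 'k::field spoly set) =
    {P_ideal n r s t S | S. maximal_switchable TYPE('k) n r s t S}"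
proof -
  let ?P = "\<lambda>S. P_ideal n r s t S :: 'k spoly set"
  have sset: "switchable_set n s t r S" if "switchable n r s t S" for S
    using that t s r by unfold_locales
  note prime = switchable_set.P_ideal_prime[OF sset]
    and I_le = switchable_set.I_ideal_subset_P_ideal[OF sset]
    and xvar = switchable_set.xvar_in_P_ideal_iff[OF sset]
    and S_subset = switchable_set.S_subset[OF sset]
  have anti: "S \<subseteq> S'" if "switchable n r s t S" "switchable n r s t S'" "?P S' \<subseteq> ?P S" for S S'
    using that xvar[where 'k = 'k] S_subset by blast
  show ?thesis
  proof (intro equalityI subsetI)
    fix Q :: "'k spoly set" assume "Q \<in> minimal_primes_over (R_ring n r s) (I_ideal n r s t)"
    then have Q: "primeideal Q (R_ring n r s)" "I_ideal n r s t \<subseteq> Q"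
        and minimal: "\<And>Q'. primeideal Q' (R_ring n r s) \<Longrightarrow> I_ideal n r s t \<subseteq> Q' \<Longrightarrow> Q' \<subseteq> Q \<Longrightarrow> Q' = Q"
      unfolding minimal_primes_over_def by blast+
    obtain S where S: "switchable n r s t S" "?P S \<subseteq> Q"
      using prime_contains_P_ideal[OF t s r Q] .
    have QS: "Q = ?P S" using minimal[OF prime[OF S(1)] I_le[OF S(1)] S(2)] by simp
    have "\<not> ?P S \<subseteq> ?P T \<and> \<not> ?P T \<subseteq> ?P S" if T: "switchable n r s t T" "S \<subset> T" for T
    proof -
      have "\<not> ?P S \<subseteq> ?P T" using anti[OF T(1) S(1)] T(2) by blast
      moreover have "?P T = ?P S" if "?P T \<subseteq> ?P S"
        using minimal[OF prime[OF T(1)] I_le[OF T(1)]] that unfolding QS by blast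
      ultimately show ?thesis by blast
    qed
    then show "Q \<in> {?P S | S. maximal_switchable TYPE('k) n r s t S}"
      using S(1) QS unfolding maximal_switchable_def by blast
  next
    fix Q :: "'k spoly set" assume "Q \<in> {?P S | S. maximal_switchable TYPE('k) n r s t S}"
    then obtain S where QS: "Q = ?P S" and S: "switchable n r s t S"
        and maximal: "\<And>T. switchable n r s t T \<Longrightarrow> S \<subset> T \<Longrightarrow> \<not> ?P T \<subseteq> ?P S"
      unfolding maximal_switchable_def by blast
    have "Q' = ?P S" if Q': "primeideal Q' (R_ring n r s)" "I_ideal n r s t \<subseteq> Q'" "Q' \<subseteq> ?P S" for Q'
    proof -
      obtain T where T: "switchable n r s t T" "?P T \<subseteq> Q'"
        using prime_contains_P_ideal[OF t s r Q'(1,2)] .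
      then have le: "?P T \<subseteq> ?P S" using Q'(3) by blast
      then have "S \<subseteq> T" using anti[OF S T(1)] by blast
      then have "S = T" using maximal[OF T(1)] le by blast
      then show ?thesis using T(2) Q'(3) by blast
    qed
    then show "Q \<in> minimal_primes_over (R_ring n r s) (I_ideal n r s t)"
      unfolding QS minimal_primes_over_def using prime[OF S] I_le[OF S] by blast
  qed
qed

theorem theorem4p4:
  fixes n s t :: nat and r :: "nat \<Rightarrow> nat"
  assumes "n \<ge> 1"
    and "\<And>i. i \<in> {1..n} \<Longrightarrow> r i \<ge> 2"
    and "s \<in> {1..n}" and "t \<in> {1..n}"
  shows "minimal_primes_over (R_ring n r s) (I_ideal n r s t :: 'k::field spoly set) =
         {P_ideal n r s t S | S. maximal_switchable TYPE('k) n r s t S}"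
proof -
  define s' where "s' = (if s = 1 then 0 else s)"
  have s': "s' \<le> n" "s' \<noteq> 1" using assms(3) by (auto simp: s'_def)
  \<comment> \<open>for \<open>s = 1\<close> the equivalence is equality, exactly as for \<open>s = 0\<close>; everything else depends on \<open>s\<close>
    only through it\<close>
  have "s_equiv n r 1 = s_equiv n r 0"
  proof -
    have "(\<Sum>i = 1..1. a i) = (\<Sum>i = 1..1. b i) \<and> (\<forall>i \<in> {1+1..n}. a i = b i) \<longleftrightarrow>
        (\<forall>i \<in> {0+1..n}. a i = b i)" for a b :: index
    proof -
      have "{0+1..n} = insert 1 {1+1..n}" using assms(1) by auto
      then show ?thesis by simp
    qed
    then show ?thesis by (simp only: s_equiv_def) simp
  qed
  then have eq: "s_equiv n r s = s_equiv n r s'" by (simp add: s'_def)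
  have R: "R_ring n r s = (R_ring n r s' :: 'k spoly ring)" unfolding R_ring_def eq ..
  have f: "fbin n r s = (fbin n r s' :: nat \<Rightarrow> index \<Rightarrow> index \<Rightarrow> 'k spoly)"
    and x: "xvar n r s = (xvar n r s' :: index \<Rightarrow> 'k spoly)"
    by (simp_all add: fun_eq_iff fbin_def xvar_def eq)
  have "I_ideal n r s t = (I_ideal n r s' t :: 'k spoly set)" unfolding I_ideal_def R f ..
  moreover have P: "P_ideal n r s t = (P_ideal n r s' t :: index set \<Rightarrow> 'k spoly set)"
    by (simp add: fun_eq_iff P_ideal_def Var_ideal_def I_tilde_def R f x)
  moreover have "maximal_switchable TYPE('k) n r s t = maximal_switchable TYPE('k) n r s' t"
    by (simp add: fun_eq_iff maximal_switchable_def switchable_def eq P)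
  ultimately show ?thesis
    using minimal_primes_eq_maximal_switchable[where r = r and 'k = 'k, OF assms(4) s' assms(2)]
    by (simp add: R)
qed

end
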